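(* Let $\mathcal{U}=(U_\alpha)_{\alpha>0}$ be a sub-Markovian resolvent of kernels on a Lusin measurable space $(E,\mathcal{B})$, let $m$ be a $\sigma$-finite $\mathcal{U}$-sub-invariant measure, and let $\mathcal{U}^\ast=(U^\ast_\alpha)_{\alpha>0}$ be the adjoint of $\mathcal{U}$ with respect to $m$. Let $1\le p<\infty$, $u\in L^p(E,m)$, and set $\mathcal{I}_p:=\{w\in L^p(E,m):\alpha U_\alpha w=w\ m\text{-a.e. for all }\alpha>0\}$. Consider the following conditions. (i) $\alpha U_\alpha u=u$ $m$-a.e. for one (and therefore for all) $\alpha>0$. (ii) $\alpha U^\ast_\alpha u=u$ $m$-a.e. for all $\alpha>0$. (iii) The function $u$ is $\mathcal{U}$-invariant. (iv) $U_\alpha u=u\,U_\alpha 1$ and $U^\ast_\alpha u=u\,U^\ast_\alpha 1$ $m$-a.e. for one (and therefore for all) $\alpha>0$. (v) The function $u$ is measurable with respect to the $\sigma$-algebra of all $\mathcal{U}$-invariant sets. Then $\mathcal{I}_p$ is a vector lattice with respect to the pointwise ($m$-a.e.) order relation, and (i) $\Leftrightarrow$ (ii) $\Rightarrow$ (iii) $\Leftrightarrow$ (iv) $\Leftrightarrow$ (v). If $\alpha U_\alpha 1=1$ $m$-a.e. for all $\alpha>0$, or $\alpha U^\ast_\alpha 1=1$ $m$-a.e. for all $\alpha>0$, then assertions (i)–(v) are equivalent. If $m(E)<\infty$ and $p=\infty$, then all of the statements above are still true.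
   Context: A sub-Markovian resolvent of kernels is a family of kernels on $(E,\mathcal{B})$ satisfying the resolvent equation and $\alpha U_\alpha 1\le 1$ for all $\alpha>0$. $p\mathcal{B}$ (resp. $bp\mathcal{B}$) denotes the positive (resp. bounded positive) $\mathcal{B}$-measurable functions. The measure $m$ is sub-invariant if $m\circ\alpha U_\alpha\le m$ for all $\alpha>0$. The adjoint $\mathcal{U}^\ast$ is a sub-Markovian resolvent of kernels on $(E,\mathcal{B})$ with $\int fU_\alpha g\,dm=\int gU^\ast_\alpha f\,dm$ for all $f,g\in p\mathcal{B}$, $\alpha>0$; it exists and is unique $m$-a.e. The kernels $U_\alpha,U^\ast_\alpha$ act as bounded operators on every $L^q(E,m)$, $1\le q\le\infty$. A real-valued function $v\in\bigcup_{1\le q\le\infty}L^q(E,m)$ is $\mathcal{U}$-invariant (with respect to $m$) if for all $\alpha>0$ and $f\in bp\mathcal{B}$ one has $U_\alpha(vf)=v\,U_\alpha f$ $m$-a.e. A set $A\in\mathcal{B}$ is $\mathcal{U}$-invariant if $1_A$ is $\mathcal{U}$-invariant; the $\mathcal{U}$-invariant sets form a $\sigma$-algebra. *)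

theory Defs
  imports "HOL-Analysis.Analysis"
begin

text \<open>
  Throughout, a measure \<open>M\<close> carries the measurable space: \<open>E\<close> is \<^term>\<open>space M\<close> and the
  sigma-algebra \<open>\<B>\<close> is \<^term>\<open>sets M\<close>.
\<close>

definition topological_borel :: "'a topology \<Rightarrow> 'a measure" where
  "topological_borel T = sigma (topspace T) {S. openin T S}"

definition measurably_isomorphic :: "'a measure \<Rightarrow> 'b measure \<Rightarrow> bool" where
  "measurably_isomorphic M N \<longleftrightarrow>
     (\<exists>f g. f \<in> measurable M N \<and> g \<in> measurable N M \<and>
        (\<forall>x\<in>space M. g (f x) = x) \<and> (\<forall>y\<in>space N. f (g y) = y))"

text \<open>
  A Lusin measurable space is measurably isomorphic to a Borel subset of a compact metrizable
  space. A compact metrizable space has at most the cardinality of the continuum, so nothing is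
  lost by taking the points of the compact space from the type \<^typ>\<open>real\<close>; the topology \<open>T\<close> and
  its underlying set are arbitrary and unrelated to the usual topology of the reals.
\<close>
definition lusin_measurable_space :: "'a measure \<Rightarrow> bool" where
  "lusin_measurable_space M \<longleftrightarrow>
     (\<exists>(T :: real topology) A. compact_space T \<and> metrizable_space T \<and>
        A \<in> sets (topological_borel T) \<and>
        measurably_isomorphic M (restrict_space (topological_borel T) A))"

definition kernel_on :: "'a measure \<Rightarrow> ('a \<Rightarrow> 'a measure) \<Rightarrow> bool" where
  "kernel_on M K \<longleftrightarrow>
     (\<forall>x\<in>space M. sets (K x) = sets M) \<and>
     (\<forall>A\<in>sets M. (\<lambda>x. emeasure (K x) A) \<in> borel_measurable M)"

text \<open>
  The resolvent equation is stated for all positive measurable (possibly infinite) functions.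
  Written additively with \<open>0 < \<alpha> \<le> \<beta>\<close> and both orders of composition, it avoids subtraction and
  amounts to \<open>U\<^sub>\<alpha> - U\<^sub>\<beta> = (\<beta> - \<alpha>) U\<^sub>\<alpha> U\<^sub>\<beta>\<close> for all \<open>\<alpha>, \<beta> > 0\<close>.
\<close>
definition resolvent_equation :: "'a measure \<Rightarrow> (real \<Rightarrow> 'a \<Rightarrow> 'a measure) \<Rightarrow> bool" where
  "resolvent_equation M U \<longleftrightarrow>
     (\<forall>\<alpha> \<beta>. 0 < \<alpha> \<longrightarrow> \<alpha> \<le> \<beta> \<longrightarrow> (\<forall>f :: 'a \<Rightarrow> ennreal. f \<in> borel_measurable M \<longrightarrow> (\<forall>x\<in>space M.
        (\<integral>\<^sup>+y. f y \<partial>U \<alpha> x) =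
          (\<integral>\<^sup>+y. f y \<partial>U \<beta> x) + ennreal (\<beta> - \<alpha>) * (\<integral>\<^sup>+y. (\<integral>\<^sup>+z. f z \<partial>U \<beta> y) \<partial>U \<alpha> x) \<and>
        (\<integral>\<^sup>+y. f y \<partial>U \<alpha> x) =
          (\<integral>\<^sup>+y. f y \<partial>U \<beta> x) + ennreal (\<beta> - \<alpha>) * (\<integral>\<^sup>+y. (\<integral>\<^sup>+z. f z \<partial>U \<alpha> y) \<partial>U \<beta> x))))"

definition sub_markovian_resolvent :: "'a measure \<Rightarrow> (real \<Rightarrow> 'a \<Rightarrow> 'a measure) \<Rightarrow> bool" where
  "sub_markovian_resolvent M U \<longleftrightarrow>
     (\<forall>\<alpha>>0. kernel_on M (U \<alpha>)) \<and>
     resolvent_equation M U \<and>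
     (\<forall>\<alpha>>0. \<forall>x\<in>space M. ennreal \<alpha> * (\<integral>\<^sup>+y. 1 \<partial>U \<alpha> x) \<le> 1)"

definition sub_invariant_measure :: "'a measure \<Rightarrow> (real \<Rightarrow> 'a \<Rightarrow> 'a measure) \<Rightarrow> bool" where
  "sub_invariant_measure m U \<longleftrightarrow>
     (\<forall>\<alpha>>0. \<forall>A\<in>sets m. (\<integral>\<^sup>+x. ennreal \<alpha> * emeasure (U \<alpha> x) A \<partial>m) \<le> emeasure m A)"

definition adjoint_resolvent ::
  "'a measure \<Rightarrow> (real \<Rightarrow> 'a \<Rightarrow> 'a measure) \<Rightarrow> (real \<Rightarrow> 'a \<Rightarrow> 'a measure) \<Rightarrow> bool" where
  "adjoint_resolvent m U V \<longleftrightarrow>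
     sub_markovian_resolvent m V \<and>
     (\<forall>\<alpha>>0. \<forall>f :: 'a \<Rightarrow> ennreal. \<forall>g :: 'a \<Rightarrow> ennreal.
        f \<in> borel_measurable m \<longrightarrow> g \<in> borel_measurable m \<longrightarrow>
        (\<integral>\<^sup>+x. f x * (\<integral>\<^sup>+y. g y \<partial>U \<alpha> x) \<partial>m) = (\<integral>\<^sup>+x. g x * (\<integral>\<^sup>+y. f y \<partial>V \<alpha> x) \<partial>m))"

text \<open>Elements of \<open>L\<^sup>q\<close> are represented by functions rather than classes, \<open>1 \<le> q \<le> \<infinity>\<close>.\<close>
definition L_space :: "ennreal \<Rightarrow> 'a measure \<Rightarrow> ('a \<Rightarrow> real) set" where
  "L_space q M = {u \<in> borel_measurable M.
     if q = \<infinity> then \<exists>C. AE x in M. \<bar>u x\<bar> \<le> C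
     else integrable M (\<lambda>x. \<bar>u x\<bar> powr enn2real q)}"

text \<open>
  The action of a kernel on real functions. For \<open>u\<close> in some \<open>L\<^sup>q\<close>, sub-invariance makes \<open>u\<close>
  integrable with respect to \<open>U \<alpha> x\<close> for almost every \<open>x\<close>, so that the value \<open>0\<close> of the
  Bochner integral of non-integrable functions is only relevant on a null set.
\<close>
definition kernel_op :: "('a \<Rightarrow> 'a measure) \<Rightarrow> ('a \<Rightarrow> real) \<Rightarrow> 'a \<Rightarrow> real" where
  "kernel_op K f x = (\<integral>y. f y \<partial>K x)"

definition bounded_pos_measurable :: "'a measure \<Rightarrow> ('a \<Rightarrow> real) set" where
  "bounded_pos_measurable M =
     {f \<in> borel_measurable M. (\<forall>x\<in>space M. 0 \<le> f x) \<and> (\<exists>C. \<forall>x\<in>space M. f x \<le> C)}"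

definition invariant_fun ::
  "'a measure \<Rightarrow> (real \<Rightarrow> 'a \<Rightarrow> 'a measure) \<Rightarrow> ('a \<Rightarrow> real) \<Rightarrow> bool" where
  "invariant_fun m U v \<longleftrightarrow>
     v \<in> (\<Union>q\<in>{1..\<infinity>}. L_space q m) \<and>
     (\<forall>\<alpha>>0. \<forall>f\<in>bounded_pos_measurable m.
        AE x in m. kernel_op (U \<alpha>) (\<lambda>y. v y * f y) x = v x * kernel_op (U \<alpha>) f x)"

definition invariant_sets :: "'a measure \<Rightarrow> (real \<Rightarrow> 'a \<Rightarrow> 'a measure) \<Rightarrow> 'a set set" where
  "invariant_sets m U = {A \<in> sets m. invariant_fun m U (indicator A)}"

lemma sub_markovian_resolventD:
  assumes "sub_markovian_resolvent M U" "0 < \<alpha>" "x \<in> space M"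
  shows "sets (U \<alpha> x) = sets M" "space (U \<alpha> x) = space M" "finite_measure (U \<alpha> x)"
proof -
  show s: "sets (U \<alpha> x) = sets M"
    using assms by (auto simp: sub_markovian_resolvent_def kernel_on_def)
  then show "space (U \<alpha> x) = space M" by (rule sets_eq_imp_space_eq)
  have "ennreal \<alpha> * emeasure (U \<alpha> x) (space (U \<alpha> x)) \<le> 1"
    using assms by (auto simp: sub_markovian_resolvent_def)
  then have "emeasure (U \<alpha> x) (space (U \<alpha> x)) \<noteq> \<infinity>"
    using \<open>0 < \<alpha>\<close> by (auto simp: ennreal_mult_eq_top_iff top_unique)
  then show "finite_measure (U \<alpha> x)" by (rule finite_measureI)
qed

lemma integrable_bounded_pos:
  assumes "sub_markovian_resolvent M U" "0 < \<alpha>" "x \<in> space M" "f \<in> bounded_pos_measurable M"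
  shows "integrable (U \<alpha> x) f"
proof -
  interpret finite_measure "U \<alpha> x" using sub_markovian_resolventD[OF assms(1-3)] by simp
  obtain C where "\<forall>x\<in>space M. \<bar>f x\<bar> \<le> C" "f \<in> borel_measurable M"
    using assms(4) by (fastforce simp: bounded_pos_measurable_def)
  then show ?thesis
    using sub_markovian_resolventD[OF assms(1-3)]
    by (intro integrable_const_bound[where B = C])
       (auto intro!: AE_I2 simp: measurable_def)
qed

lemma bounded_pos_indicator_mult:
  assumes "A \<in> sets M" "f \<in> bounded_pos_measurable M"
  shows "(\<lambda>x. indicator A x * f x) \<in> bounded_pos_measurable M"
proof -
  obtain C where C: "\<forall>x\<in>space M. 0 \<le> f x \<and> f x \<le> C" and [measurable]: "f \<in> borel_measurable M"
    using assms(2) by (auto simp: bounded_pos_measurable_def)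
  note assms(1)[measurable]
  have "(\<lambda>x. indicator A x * f x) \<in> borel_measurable M" by measurable
  then show ?thesis using C
    by (auto simp: bounded_pos_measurable_def indicator_def intro!: exI[of _ C] order_trans[of 0 "f _" C])
qed

lemma invariant_setsI:
  assumes "A \<in> sets m"
    and "\<And>\<alpha> f. 0 < \<alpha> \<Longrightarrow> f \<in> bounded_pos_measurable m \<Longrightarrow>
      AE x in m. kernel_op (U \<alpha>) (\<lambda>y. indicator A y * f y) x = indicator A x * kernel_op (U \<alpha>) f x"
  shows "A \<in> invariant_sets m U"
proof -
  have "(indicator A :: _ \<Rightarrow> real) \<in> L_space \<infinity> m"
    using assms(1) by (auto simp: L_space_def indicator_def intro!: exI[of _ 1])
  then show ?thesis
    using assms by (auto simp: invariant_sets_def invariant_fun_def intro!: bexI[of _ \<infinity>])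
qed

lemma invariant_setsD:
  assumes "A \<in> invariant_sets m U" "0 < \<alpha>" "f \<in> bounded_pos_measurable m"
  shows "AE x in m. kernel_op (U \<alpha>) (\<lambda>y. indicator A y * f y) x = indicator A x * kernel_op (U \<alpha>) f x"
  using assms by (auto simp: invariant_sets_def invariant_fun_def)

lemma sigma_algebra_invariant_sets:
  assumes U: "sub_markovian_resolvent m U"
  shows "sigma_algebra (space m) (invariant_sets m U)"
proof -
  have sub: "A \<in> sets m" if "A \<in> invariant_sets m U" for A
    using that by (auto simp: invariant_sets_def)
  have empty: "{} \<in> invariant_sets m U"
    by (rule invariant_setsI) (auto simp: kernel_op_def)
  have compl: "space m - A \<in> invariant_sets m U" if A: "A \<in> invariant_sets m U" for A
  proof (rule invariant_setsI)
    show "space m - A \<in> sets m" using sub[OF A] by auto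
    fix \<alpha> :: real and f assume \<alpha>: "0 < \<alpha>" and f: "f \<in> bounded_pos_measurable m"
    show "AE x in m. kernel_op (U \<alpha>) (\<lambda>y. indicator (space m - A) y * f y) x
            = indicator (space m - A) x * kernel_op (U \<alpha>) f x"
      using invariant_setsD[OF A \<alpha> f] AE_space
    proof eventually_elim
      case (elim x)
      note D = sub_markovian_resolventD[OF U \<alpha> elim(2)]
      have "kernel_op (U \<alpha>) (\<lambda>y. indicator (space m - A) y * f y) x
          = (\<integral>y. f y - indicator A y * f y \<partial>U \<alpha> x)"
        unfolding kernel_op_def using D(2)
        by (intro Bochner_Integration.integral_cong) (auto simp: indicator_def)
      also have "\<dots> = kernel_op (U \<alpha>) f x - kernel_op (U \<alpha>) (\<lambda>y. indicator A y * f y) x"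
        unfolding kernel_op_def
        by (intro Bochner_Integration.integral_diff integrable_bounded_pos[OF U \<alpha> elim(2)]
              bounded_pos_indicator_mult f sub[OF A])
      finally show ?case using elim by (auto simp: indicator_def)
    qed
  qed
  have int: "A \<inter> B \<in> invariant_sets m U"
    if A: "A \<in> invariant_sets m U" and B: "B \<in> invariant_sets m U" for A B
  proof (rule invariant_setsI)
    show "A \<inter> B \<in> sets m" using sub[OF A] sub[OF B] by auto
    fix \<alpha> :: real and f assume \<alpha>: "0 < \<alpha>" and f: "f \<in> bounded_pos_measurable m"
    show "AE x in m. kernel_op (U \<alpha>) (\<lambda>y. indicator (A \<inter> B) y * f y) x
            = indicator (A \<inter> B) x * kernel_op (U \<alpha>) f x"
      using invariant_setsD[OF A \<alpha> bounded_pos_indicator_mult[OF sub[OF B] f]]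
        invariant_setsD[OF B \<alpha> f]
      by eventually_elim (simp add: indicator_inter_arith mult.assoc)
  qed
  interpret algebra "space m" "invariant_sets m U"
    using sub sets.space_closed empty compl int
    by (auto simp: algebra_iff_Int)
  show ?thesis
  proof (rule sigma_algebra_disjoint_iff[THEN iffD2], intro conjI allI impI)
    show "algebra (space m) (invariant_sets m U)" by unfold_locales
    fix A :: "nat \<Rightarrow> 'a set"
    assume "range A \<subseteq> invariant_sets m U"
    then have A: "A i \<in> invariant_sets m U" for i by auto
    define B where "B n = (\<Union>i\<in>{..<n}. A i)" for n
    have B: "B n \<in> invariant_sets m U" for n
      unfolding B_def using A by (intro finite_UN) auto
    show "(\<Union>i. A i) \<in> invariant_sets m U"
    proof (rule invariant_setsI)
      show UA: "(\<Union>i. A i) \<in> sets m" using sub[OF A] by auto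
      fix \<alpha> :: real and f assume \<alpha>: "0 < \<alpha>" and f: "f \<in> bounded_pos_measurable m"
      have "AE x in m. \<forall>n. kernel_op (U \<alpha>) (\<lambda>y. indicator (B n) y * f y) x
          = indicator (B n) x * kernel_op (U \<alpha>) f x"
        using invariant_setsD[OF B \<alpha> f] by (simp add: AE_all_countable)
      then show "AE x in m. kernel_op (U \<alpha>) (\<lambda>y. indicator (\<Union>i. A i) y * f y) x
          = indicator (\<Union>i. A i) x * kernel_op (U \<alpha>) f x"
        using AE_space
      proof eventually_elim
        case (elim x)
        note D = sub_markovian_resolventD[OF U \<alpha> elim(2)]
        have lim: "(\<lambda>n. indicator (B n) y :: real) \<longlonglongrightarrow> indicator (\<Union>i. A i) y" for y
          unfolding B_def by (rule LIMSEQ_indicator_UN)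
        have meas: "h \<in> borel_measurable (U \<alpha> x)" if "h \<in> bounded_pos_measurable m" for h
          using that integrable_bounded_pos[OF U \<alpha> elim(2)] by auto
        have "(\<lambda>n. \<integral>y. indicator (B n) y * f y \<partial>U \<alpha> x)
            \<longlonglongrightarrow> (\<integral>y. indicator (\<Union>i. A i) y * f y \<partial>U \<alpha> x)"
        proof (rule integral_dominated_convergence[where w = f])
          show "integrable (U \<alpha> x) f" by (rule integrable_bounded_pos[OF U \<alpha> elim(2) f])
          show "(\<lambda>y. indicator (B n) y * f y) \<in> borel_measurable (U \<alpha> x)" for n
            by (intro meas bounded_pos_indicator_mult sub B f)
          show "(\<lambda>y. indicator (\<Union>i. A i) y * f y) \<in> borel_measurable (U \<alpha> x)"
            by (intro meas bounded_pos_indicator_mult UA f)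
          show "AE y in U \<alpha> x. norm (indicator (B n) y * f y) \<le> f y" for n
            using f D(2) by (intro AE_I2) (auto simp: bounded_pos_measurable_def indicator_def)
        qed (intro AE_I2 tendsto_intros lim)
        moreover have "(\<lambda>n. \<integral>y. indicator (B n) y * f y \<partial>U \<alpha> x)
            \<longlonglongrightarrow> indicator (\<Union>i. A i) x * kernel_op (U \<alpha>) f x"
          using elim(1) unfolding kernel_op_def by (simp, intro tendsto_intros lim)
        ultimately show ?case
          unfolding kernel_op_def by (rule LIMSEQ_unique)
      qed
    qed
  qed
qed

definition invariant_sigma_algebra ::
  "'a measure \<Rightarrow> (real \<Rightarrow> 'a \<Rightarrow> 'a measure) \<Rightarrow> 'a measure" where
  "invariant_sigma_algebra m U = sigma (space m) (invariant_sets m U)"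

lemma sets_invariant_sigma_algebra:
  "sub_markovian_resolvent m U \<Longrightarrow> sets (invariant_sigma_algebra m U) = invariant_sets m U"
  by (simp add: invariant_sigma_algebra_def sigma_algebra.sets_measure_of_eq
      sigma_algebra_invariant_sets)

definition invariant_Lp ::
  "ennreal \<Rightarrow> 'a measure \<Rightarrow> (real \<Rightarrow> 'a \<Rightarrow> 'a measure) \<Rightarrow> ('a \<Rightarrow> real) set" where
  "invariant_Lp p m U =
     {w \<in> L_space p m. \<forall>\<alpha>>0. AE x in m. \<alpha> * kernel_op (U \<alpha>) w x = w x}"

definition ae_le :: "'a measure \<Rightarrow> ('a \<Rightarrow> real) \<Rightarrow> ('a \<Rightarrow> real) \<Rightarrow> bool" where
  "ae_le m v w \<longleftrightarrow> (AE x in m. v x \<le> w x)"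

definition ae_sup_in ::
  "'a measure \<Rightarrow> ('a \<Rightarrow> real) set \<Rightarrow> ('a \<Rightarrow> real) \<Rightarrow> ('a \<Rightarrow> real) \<Rightarrow> ('a \<Rightarrow> real) \<Rightarrow> bool" where
  "ae_sup_in m W v w s \<longleftrightarrow>
     s \<in> W \<and> ae_le m v s \<and> ae_le m w s \<and>
     (\<forall>t\<in>W. ae_le m v t \<longrightarrow> ae_le m w t \<longrightarrow> ae_le m s t)"

definition ae_inf_in ::
  "'a measure \<Rightarrow> ('a \<Rightarrow> real) set \<Rightarrow> ('a \<Rightarrow> real) \<Rightarrow> ('a \<Rightarrow> real) \<Rightarrow> ('a \<Rightarrow> real) \<Rightarrow> bool" where
  "ae_inf_in m W v w s \<longleftrightarrow>
     s \<in> W \<and> ae_le m s v \<and> ae_le m s w \<and>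
     (\<forall>t\<in>W. ae_le m t v \<longrightarrow> ae_le m t w \<longrightarrow> ae_le m t s)"

text \<open>
  \<open>W\<close> is a set of representatives, preordered by \<^const>\<open>ae_le\<close>, so suprema and infima are
  determined up to equality almost everywhere. Compatibility of the order with addition and with
  multiplication by positive scalars is automatic for \<^const>\<open>ae_le\<close>.
\<close>
definition ae_vector_lattice :: "'a measure \<Rightarrow> ('a \<Rightarrow> real) set \<Rightarrow> bool" where
  "ae_vector_lattice m W \<longleftrightarrow>
     (\<lambda>x. 0) \<in> W \<and>
     (\<forall>v\<in>W. \<forall>w\<in>W. (\<lambda>x. v x + w x) \<in> W) \<and>
     (\<forall>c. \<forall>v\<in>W. (\<lambda>x. c * v x) \<in> W) \<and>
     (\<forall>v\<in>W. \<forall>w\<in>W. (\<exists>s. ae_sup_in m W v w s) \<and> (\<exists>s. ae_inf_in m W v w s))"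

end

(* All conditions are read off the property that for almost every x the measure U_alpha x is
   carried by the level set {y. u y = u x} ("constant_along").  The conditions (III) and (V) both
   say exactly this for all alpha; it passes to other parameters by the resolvent equation and to
   the adjoint by duality.

   The only consequence of u in L^p that matters is that (|u| - c)^+ is m-integrable for c > 0.
   Under (I), or under the two equations of (IV), Jensen's inequality for the truncations (u - c)^+
   and (-u - c)^+ integrates to an equality, because the kernels do not increase integrals (for
   (I)) or because the kernel and its adjoint can be played against each other (for (IV)).  The
   equality case says that no mass crosses the level c, and letting c run through the positive
   rationals gives the level set property.  Condition (I) adds that the kernel has full mass where
   u is nonzero; this too is inherited by other parameters and by the adjoint, and it is stable
   under all operations h(v, w) with h(0, 0) = 0, which gives the lattice statement. *)

theory Submission
  imports Defs
begin

section \<open>Level sets, pairs of sets without transport, and integrable tails\<close>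

definition constant_along :: "'a measure \<Rightarrow> ('a \<Rightarrow> 'a measure) \<Rightarrow> ('a \<Rightarrow> real) \<Rightarrow> bool" where
  "constant_along m K u \<longleftrightarrow> (AE x in m. AE y in K x. u y = u x)"

text \<open>Pairs of sets are the form on which duality and the resolvent equation act directly. The
  condition is one-sided because duality reverses the direction of transport.\<close>

definition unlinked :: "'a measure \<Rightarrow> ('a \<Rightarrow> 'a measure) \<Rightarrow> 'a set \<Rightarrow> 'a set \<Rightarrow> bool" where
  "unlinked m K A B \<longleftrightarrow> (AE x in m. x \<in> A \<longrightarrow> emeasure (K x) B = 0)"

text \<open>\<open>ennreal\<close> sends negative reals to 0, so the integrand is the positive part
  of \<open>\<bar>u x\<bar> - c\<close>. Requiring \<open>c > 0\<close> only lets the condition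
  cover every finite exponent, and bounded functions when \<open>m\<close> is finite.\<close>

definition tails_integrable :: "'a measure \<Rightarrow> ('a \<Rightarrow> real) \<Rightarrow> bool" where
  "tails_integrable m u \<longleftrightarrow>
     u \<in> borel_measurable m \<and> (\<forall>c>0. (\<integral>\<^sup>+x. ennreal (\<bar>u x\<bar> - c) \<partial>m) < \<infinity>)"

section \<open>Jensen's inequality for truncations and its equality case\<close>

text \<open>Place the missing mass \<open>h - measure M (space M)\<close> at the value 0: then
  \<open>t\<close> is the mean of \<open>u\<close> for the total mass \<open>h\<close>. For
  \<open>c \<ge> 0\<close> the truncation at \<open>c\<close> vanishes at 0, so the added mass
  contributes nothing.\<close>

lemma (in finite_measure) truncated_jensen:
  fixes u :: "'a \<Rightarrow> real"
  assumes u: "integrable M u" and "0 \<le> c" "measure M (space M) \<le> h" "integral\<^sup>L M u = t * h"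
  shows "ennreal (h * (t - c)) \<le> (\<integral>\<^sup>+y. ennreal (u y - c) \<partial>M)"
proof -
  have "h * (t - c) \<le> (\<integral>y. u y - c \<partial>M)"
    using assms mult_left_mono[of "measure M (space M)" h c]
    by (simp add: algebra_simps)
  also have "\<dots> \<le> (\<integral>y. max 0 (u y - c) \<partial>M)"
    using u by (intro integral_mono) auto
  finally have "ennreal (h * (t - c)) \<le> ennreal (\<integral>y. max 0 (u y - c) \<partial>M)"
    by (rule ennreal_leI)
  also have "\<dots> = (\<integral>\<^sup>+y. ennreal (max 0 (u y - c)) \<partial>M)"
    using u by (intro nn_integral_eq_integral[symmetric]) auto
  finally show ?thesis by (simp add: ennreal_max_0)
qed

text \<open>For \<open>t \<le> c\<close> the upper bound is 0, so the positive part of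
  \<open>u - c\<close> vanishes. For \<open>c < t\<close> the integral of \<open>u - c\<close> and
  that of its positive part are squeezed between two copies of \<open>h * (t - c)\<close>. Equality
  below forces full mass, because \<open>c > 0\<close>; equality above forces
  \<open>u \<ge> c\<close>.\<close>

lemma (in finite_measure) truncated_jensen_eq:
  fixes u :: "'a \<Rightarrow> real"
  assumes u: "integrable M u" and c: "0 < c" and h: "measure M (space M) \<le> h"
    and t: "integral\<^sup>L M u = t * h"
    and le: "(\<integral>\<^sup>+y. ennreal (u y - c) \<partial>M) \<le> ennreal (h * (t - c))"
  shows "t \<le> c \<Longrightarrow> AE y in M. u y \<le> c"
    and "c < t \<Longrightarrow> AE y in M. c \<le> u y"
    and "c < t \<Longrightarrow> measure M (space M) = h"
proof -
  have h0: "0 \<le> h" using h measure_nonneg[of M "space M"] by linarith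
  note [measurable] = borel_measurable_integrable[OF u]
  { assume "t \<le> c"
    then have "h * (t - c) \<le> 0" using h0 by (simp add: mult_nonneg_nonpos)
    then have "(\<integral>\<^sup>+y. ennreal (u y - c) \<partial>M) = 0" using le by (simp add: ennreal_neg)
    then have "AE y in M. ennreal (u y - c) = 0" by (subst (asm) nn_integral_0_iff_AE) auto
    then show "AE y in M. u y \<le> c" by eventually_elim (simp add: ennreal_eq_0_iff) }
  assume "c < t"
  let ?J = "\<integral>y. max 0 (u y - c) \<partial>M" and ?k = "measure M (space M)"
  have "ennreal ?J = (\<integral>\<^sup>+y. ennreal (max 0 (u y - c)) \<partial>M)"
    using u by (intro nn_integral_eq_integral[symmetric]) auto
  also have "\<dots> \<le> ennreal (h * (t - c))" using le by (simp add: ennreal_max_0)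
  finally have J: "?J \<le> h * (t - c)"
    using h0 \<open>c < t\<close> by (subst (asm) ennreal_le_iff) auto
  have I: "(\<integral>y. u y - c \<partial>M) = t * h - c * ?k" using u t by simp
  have IJ: "(\<integral>y. u y - c \<partial>M) \<le> ?J" using u by (intro integral_mono) auto
  from J I IJ have "c * h \<le> c * ?k" by (simp add: algebra_simps)
  then show k: "?k = h" using c h by simp
  \<comment> \<open>The integrand is the negative part of \<open>u - c\<close>.\<close>
  have "(\<integral>y. max 0 (u y - c) - (u y - c) \<partial>M) = ?J - (\<integral>y. u y - c \<partial>M)"
    using u by (intro Bochner_Integration.integral_diff) auto
  then have "(\<integral>y. max 0 (u y - c) - (u y - c) \<partial>M) = 0"
    using I J IJ k by (simp add: algebra_simps)
  moreover have "integrable M (\<lambda>y. max 0 (u y - c) - (u y - c))" using u by auto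
  ultimately have "AE y in M. max 0 (u y - c) - (u y - c) = 0"
    by (subst (asm) integral_nonneg_eq_0_iff_AE) auto
  then show "AE y in M. c \<le> u y" by eventually_elim simp
qed

lemma real_eq_if_same_rats_above:
  fixes s t :: real
  assumes "\<And>q. q \<in> \<rat> \<Longrightarrow> s < q \<longleftrightarrow> t < q"
  shows "s = t"
  using assms Rats_dense_in_real[of s t] Rats_dense_in_real[of t s]
  by (metis linorder_neqE_linordered_idom order_less_asym)

section \<open>A single kernel that does not increase integrals\<close>

text \<open>The level set arguments work at one fixed parameter, and both the kernels of the
  resolvent and those of its adjoint are instances. Sub-invariance is required for positive
  functions, the form in which duality delivers it.\<close>

locale kernel_sub_invariant =
  fixes m :: "'a measure" and K :: "'a \<Rightarrow> 'a measure" and \<alpha> :: real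
  assumes pos: "0 < \<alpha>"
    and kernel: "kernel_on m K"
    and mass: "x \<in> space m \<Longrightarrow> ennreal \<alpha> * (\<integral>\<^sup>+y. 1 \<partial>K x) \<le> 1"
    and sub_invariant: "g \<in> borel_measurable m \<Longrightarrow>
      ennreal \<alpha> * (\<integral>\<^sup>+x. \<integral>\<^sup>+y. g y \<partial>K x \<partial>m) \<le> (\<integral>\<^sup>+x. g x \<partial>m)"
begin

lemma sets_kernel: "x \<in> space m \<Longrightarrow> sets (K x) = sets m"
  using kernel by (auto simp: kernel_on_def)

lemma space_kernel: "x \<in> space m \<Longrightarrow> space (K x) = space m"
  by (rule sets_eq_imp_space_eq[OF sets_kernel])

lemma measurable_kernel_cong: "x \<in> space m \<Longrightarrow> measurable (K x) N = measurable m N"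
  by (intro measurable_cong_sets sets_kernel) auto

lemma finite_kernel: "x \<in> space m \<Longrightarrow> finite_measure (K x)"
proof (rule finite_measureI)
  assume "x \<in> space m"
  from mass[OF this] have "emeasure (K x) (space (K x)) \<noteq> top"
    using pos by (auto simp: ennreal_mult_eq_top_iff top_unique)
  then show "emeasure (K x) (space (K x)) \<noteq> \<infinity>" by simp
qed

lemma ennreal_mass: "x \<in> space m \<Longrightarrow> (\<integral>\<^sup>+y. 1 \<partial>K x) = ennreal (measure (K x) (space m))"
  using finite_measure.emeasure_eq_measure[OF finite_kernel, of x "space m"]
  by (simp add: space_kernel)

lemma measure_le: "x \<in> space m \<Longrightarrow> measure (K x) (space m) \<le> 1 / \<alpha>"
  using mass[of x] pos
  by (simp add: ennreal_mass ennreal_mult[symmetric] pos_le_divide_eq mult.commute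
      del: nn_integral_const)

lemma kernel_op_one: "x \<in> space m \<Longrightarrow> kernel_op K (\<lambda>_. 1) x = measure (K x) (space m)"
  by (simp add: kernel_op_def space_kernel)

lemma measurable_emeasure [measurable]:
  "A \<in> sets m \<Longrightarrow> (\<lambda>x. emeasure (K x) A) \<in> borel_measurable m"
  using kernel by (auto simp: kernel_on_def)

lemma measurable_mass [measurable]: "(\<lambda>x. emeasure (K x) (space (K x))) \<in> borel_measurable m"
  using measurable_emeasure[OF sets.top] by (simp add: space_kernel cong: measurable_cong)

lemma measurable_measure [measurable]:
  "A \<in> sets m \<Longrightarrow> (\<lambda>x. measure (K x) A) \<in> borel_measurable m"
  unfolding measure_def by measurable

text \<open>Measurability passes from sets to functions by approximation with simple functions. The
  integral identities are restricted to \<open>space m\<close>, since \<open>kernel_on\<close> does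
  not constrain \<open>K x\<close> elsewhere.\<close>

lemma measurable_nn_integral [measurable]:
  "g \<in> borel_measurable m \<Longrightarrow> (\<lambda>x. \<integral>\<^sup>+y. g y \<partial>K x) \<in> borel_measurable m"
proof (induction rule: borel_measurable_induct)
  case (cong f g)
  then have "(\<integral>\<^sup>+y. f y \<partial>K x) = (\<integral>\<^sup>+y. g y \<partial>K x)" if "x \<in> space m" for x
    using that by (intro nn_integral_cong) (auto simp: space_kernel)
  then show ?case using cong by (simp cong: measurable_cong)
next
  case (set A)
  have "(\<integral>\<^sup>+y. indicator A y \<partial>K x) = emeasure (K x) A" if "x \<in> space m" for x
    using that set by (simp add: sets_kernel)
  then show ?case using measurable_emeasure[OF set] by (simp cong: measurable_cong)
next
  case (mult u c)
  have "(\<integral>\<^sup>+y. c * u y \<partial>K x) = c * (\<integral>\<^sup>+y. u y \<partial>K x)" if "x \<in> space m" for x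
    using that mult by (intro nn_integral_cmult) (simp add: measurable_kernel_cong)
  moreover have "(\<lambda>x. c * (\<integral>\<^sup>+y. u y \<partial>K x)) \<in> borel_measurable m" using mult by measurable
  ultimately show ?case by (simp cong: measurable_cong)
next
  case (add u v)
  have "(\<integral>\<^sup>+y. v y + u y \<partial>K x) = (\<integral>\<^sup>+y. v y \<partial>K x) + (\<integral>\<^sup>+y. u y \<partial>K x)"
    if "x \<in> space m" for x
    using that add by (intro nn_integral_add) (simp_all add: measurable_kernel_cong)
  moreover have "(\<lambda>x. (\<integral>\<^sup>+y. v y \<partial>K x) + (\<integral>\<^sup>+y. u y \<partial>K x)) \<in> borel_measurable m"
    using add by measurable
  ultimately show ?case by (simp cong: measurable_cong)
next
  case (seq F)
  have "(\<integral>\<^sup>+y. (SUP i. F i) y \<partial>K x) = (SUP i. \<integral>\<^sup>+y. F i y \<partial>K x)" if "x \<in> space m" for x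
    using that seq unfolding SUP_apply
    by (intro nn_integral_monotone_convergence_SUP) (simp_all add: measurable_kernel_cong)
  moreover have "(\<lambda>x. SUP i. \<integral>\<^sup>+y. F i y \<partial>K x) \<in> borel_measurable m" using seq by measurable
  ultimately show ?case by (simp cong: measurable_cong)
qed

text \<open>Sub-invariance for the indicator of an \<open>m\<close>-null set shows that almost every
  \<open>K x\<close> ignores it. Hence statements known almost everywhere can be used under a
  further kernel integral.\<close>

lemma AE_kernel:
  assumes "AE x in m. P x"
  shows "AE x in m. AE y in K x. P y"
proof -
  obtain N where N: "{x \<in> space m. \<not> P x} \<subseteq> N" "emeasure m N = 0" "N \<in> sets m"
    using assms by (rule AE_E)
  have "ennreal \<alpha> * (\<integral>\<^sup>+x. \<integral>\<^sup>+y. indicator N y \<partial>K x \<partial>m) = 0"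
    using sub_invariant[of "indicator N"] N by simp
  then have "(\<integral>\<^sup>+x. \<integral>\<^sup>+y. indicator N y \<partial>K x \<partial>m) = 0"
    using pos by (simp add: ennreal_eq_0_iff)
  then have "AE x in m. (\<integral>\<^sup>+y. indicator N y \<partial>K x) = 0"
    using N by (subst (asm) nn_integral_0_iff_AE) auto
  then show ?thesis using AE_space
  proof eventually_elim
    case (elim x)
    then show ?case using N
      by (intro AE_I[of _ _ N]) (auto simp: space_kernel sets_kernel)
  qed
qed

text \<open>Since |u| is at most 1 plus the positive part of |u| - 1, finite mass and sub-invariance
  suffice. This rules out, up to a null set, that \<open>kernel_op K u x\<close> is the default
  value 0 of a non-integrable function.\<close>

lemma AE_integrable:
  assumes "tails_integrable m u"
  shows "AE x in m. integrable (K x) u"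
proof -
  have u[measurable]: "u \<in> borel_measurable m" and fin: "(\<integral>\<^sup>+x. ennreal (\<bar>u x\<bar> - 1) \<partial>m) < \<infinity>"
    using assms by (auto simp: tails_integrable_def)
  have "ennreal \<alpha> * (\<integral>\<^sup>+x. \<integral>\<^sup>+y. ennreal (\<bar>u y\<bar> - 1) \<partial>K x \<partial>m) < \<infinity>"
    using sub_invariant[of "\<lambda>y. ennreal (\<bar>u y\<bar> - 1)"] fin by (simp add: order_le_less_trans)
  then have "(\<integral>\<^sup>+x. \<integral>\<^sup>+y. ennreal (\<bar>u y\<bar> - 1) \<partial>K x \<partial>m) \<noteq> \<infinity>"
    using pos by (auto simp: ennreal_mult_less_top)
  then have "AE x in m. (\<integral>\<^sup>+y. ennreal (\<bar>u y\<bar> - 1) \<partial>K x) \<noteq> \<infinity>"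
    by (intro nn_integral_PInf_AE) auto
  then show ?thesis using AE_space
  proof eventually_elim
    case (elim x)
    note [measurable] = u[unfolded measurable_kernel_cong[OF elim(2), symmetric]]
    have "(\<integral>\<^sup>+y. ennreal (norm (u y)) \<partial>K x) \<le> (\<integral>\<^sup>+y. 1 + ennreal (\<bar>u y\<bar> - 1) \<partial>K x)"
    proof (intro nn_integral_mono)
      fix y
      have "ennreal (norm (u y)) \<le> ennreal (1 + max 0 (\<bar>u y\<bar> - 1))" by (intro ennreal_leI) auto
      also have "\<dots> = 1 + ennreal (\<bar>u y\<bar> - 1)" by (subst ennreal_plus) (auto simp: ennreal_max_0)
      finally show "ennreal (norm (u y)) \<le> 1 + ennreal (\<bar>u y\<bar> - 1)" .
    qed
    also have "\<dots> = (\<integral>\<^sup>+y. 1 \<partial>K x) + (\<integral>\<^sup>+y. ennreal (\<bar>u y\<bar> - 1) \<partial>K x)"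
      by (intro nn_integral_add) auto
    also have "\<dots> < \<infinity>"
      using elim unfolding ennreal_mass[OF elim(2)] by (simp add: less_top)
    finally show ?case by (intro integrableI_bounded) auto
  qed
qed

text \<open>The bound \<open>h\<close> is left open because two choices occur: the constant
  \<open>1 / \<alpha>\<close> for condition (I), and the mass of the kernel itself for condition
  (IV).\<close>

lemma AE_truncated_jensen:
  assumes u: "tails_integrable m u" and c: "0 \<le> c"
    and h: "AE x in m. measure (K x) (space m) \<le> h x"
    and eq: "AE x in m. kernel_op K u x = u x * h x"
  shows "AE x in m. ennreal (h x * (u x - c)) \<le> (\<integral>\<^sup>+y. ennreal (u y - c) \<partial>K x)"
  using AE_integrable[OF u] h eq AE_space
proof eventually_elim
  case (elim x)
  then show ?case using c
    by (intro finite_measure.truncated_jensen[OF finite_kernel])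
       (auto simp: kernel_op_def space_kernel)
qed

text \<open>If the truncations of \<open>u\<close> lose no mass under the kernel, then Jensen's inequality is an
  equality at almost every point, and this keeps the kernel from crossing the level \<open>c\<close>.\<close>
lemma AE_truncated_jensen_eq:
  assumes u: "tails_integrable m u" and c: "0 < c"
    and hm[measurable]: "h \<in> borel_measurable m"
    and h: "AE x in m. measure (K x) (space m) \<le> h x" "\<And>x. x \<in> space m \<Longrightarrow> h x \<le> 1 / \<alpha>"
    and eq: "AE x in m. kernel_op K u x = u x * h x"
    and le: "(\<integral>\<^sup>+x. \<integral>\<^sup>+y. ennreal (u y - c) \<partial>K x \<partial>m) \<le> (\<integral>\<^sup>+x. ennreal (h x * (u x - c)) \<partial>m)"
  shows "AE x in m. (if u x \<le> c then AE y in K x. u y \<le> c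
     else (AE y in K x. c \<le> u y) \<and> measure (K x) (space m) = h x)"
proof -
  have um[measurable]: "u \<in> borel_measurable m" using u by (auto simp: tails_integrable_def)
  have J: "AE x in m. ennreal (h x * (u x - c)) \<le> (\<integral>\<^sup>+y. ennreal (u y - c) \<partial>K x)"
    using AE_truncated_jensen[OF u _ h(1) eq] c by simp
  \<comment> \<open>Finiteness is needed before integrals can be subtracted in
    \<open>ennreal\<close>; it comes from \<open>h \<le> 1 / \<alpha>\<close> and the integrable
    tail.\<close>
  have "(\<integral>\<^sup>+x. ennreal (h x * (u x - c)) \<partial>m) \<le> (\<integral>\<^sup>+x. ennreal (1 / \<alpha>) * ennreal (\<bar>u x\<bar> - c) \<partial>m)"
  proof (intro nn_integral_mono_AE)
    show "AE x in m. ennreal (h x * (u x - c)) \<le> ennreal (1 / \<alpha>) * ennreal (\<bar>u x\<bar> - c)"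
      using h(1) AE_space
    proof eventually_elim
      case (elim x)
      have h0: "0 \<le> h x" using elim measure_nonneg[of "K x" "space m"] by linarith
      have "h x * (u x - c) \<le> h x * max 0 (\<bar>u x\<bar> - c)"
        using h0 by (intro mult_left_mono) auto
      also have "\<dots> \<le> 1 / \<alpha> * max 0 (\<bar>u x\<bar> - c)"
        using h(2)[OF elim(2)] by (intro mult_right_mono) auto
      finally have "ennreal (h x * (u x - c)) \<le> ennreal (1 / \<alpha> * max 0 (\<bar>u x\<bar> - c))"
        by (rule ennreal_leI)
      then show ?case using pos by (subst (asm) (2) ennreal_mult) (auto simp: ennreal_max_0)
    qed
  qed
  also have "\<dots> = ennreal (1 / \<alpha>) * (\<integral>\<^sup>+x. ennreal (\<bar>u x\<bar> - c) \<partial>m)"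
    by (intro nn_integral_cmult) auto
  also have "\<dots> < \<infinity>" using u c by (auto simp: tails_integrable_def ennreal_mult_less_top)
  finally have fin: "(\<integral>\<^sup>+x. ennreal (h x * (u x - c)) \<partial>m) \<noteq> \<infinity>" by simp
  \<comment> \<open>By \<open>J\<close> the integrand is the gap in Jensen's inequality; by
    \<open>le\<close> its integral is 0, so the gap closes almost everywhere.\<close>
  have "(\<integral>\<^sup>+x. (\<integral>\<^sup>+y. ennreal (u y - c) \<partial>K x) - ennreal (h x * (u x - c)) \<partial>m)
      = (\<integral>\<^sup>+x. \<integral>\<^sup>+y. ennreal (u y - c) \<partial>K x \<partial>m) - (\<integral>\<^sup>+x. ennreal (h x * (u x - c)) \<partial>m)"
    using fin J by (intro nn_integral_diff) auto
  also have "\<dots> = 0"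
    using le fin by (auto simp: diff_eq_0_iff_ennreal less_top intro: order_le_less_trans)
  finally have "AE x in m. (\<integral>\<^sup>+y. ennreal (u y - c) \<partial>K x) - ennreal (h x * (u x - c)) = 0"
    by (subst (asm) nn_integral_0_iff_AE) auto
  then show ?thesis using AE_integrable[OF u] h(1) eq AE_space
  proof eventually_elim
    case (elim x)
    interpret finite_measure "K x" using elim by (intro finite_kernel)
    have le': "(\<integral>\<^sup>+y. ennreal (u y - c) \<partial>K x) \<le> ennreal (h x * (u x - c))"
      using elim(1) by (simp add: ennreal_minus_eq_0)
    have "measure (K x) (space (K x)) \<le> h x" "integral\<^sup>L (K x) u = u x * h x"
      using elim by (auto simp: kernel_op_def space_kernel)
    from truncated_jensen_eq[OF elim(2) c this le'] elim(5) show ?case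
      by (auto simp: space_kernel)
  qed
qed

lemma kernel_op_constant_along:
  assumes [measurable]: "u \<in> borel_measurable m" "f \<in> borel_measurable m"
    and "constant_along m K u"
  shows "AE x in m. kernel_op K (\<lambda>y. u y * f y) x = u x * kernel_op K f x"
  using assms(3) AE_space unfolding constant_along_def
proof eventually_elim
  case (elim x)
  have "kernel_op K (\<lambda>y. u y * f y) x = (\<integral>y. u x * f y \<partial>K x)"
    unfolding kernel_op_def using elim
    by (intro integral_cong_AE) (auto simp: measurable_kernel_cong)
  then show ?case by (simp add: kernel_op_def)
qed

text \<open>Two reals agree as soon as they lie below the same rationals, and a countable quantifier
  commutes with both layers of AE. The level set property thus becomes countably many statements
  about a set and its complement.\<close>

lemma constant_along_iff_unlinked:
  assumes [measurable]: "u \<in> borel_measurable m"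
  shows "constant_along m K u \<longleftrightarrow>
    (\<forall>q\<in>\<rat>. unlinked m K {x\<in>space m. u x < q} (space m - {x\<in>space m. u x < q}) \<and>
       unlinked m K (space m - {x\<in>space m. u x < q}) {x\<in>space m. u x < q})"
    (is "_ \<longleftrightarrow> (\<forall>q\<in>\<rat>. unlinked m K (?A q) (?B q) \<and> _ q)")
proof -
  have [measurable]: "?A q \<in> sets m" for q by measurable
  have null: "emeasure (K x) C = 0 \<longleftrightarrow> (AE y in K x. y \<notin> C)"
    if "x \<in> space m" "C \<in> sets m" for x C
    using that
    by (subst AE_iff_measurable[of C])
       (auto simp: sets_kernel space_kernel dest: sets.sets_into_space)
  have "constant_along m K u \<longleftrightarrow> (AE x in m. AE y in K x. \<forall>q\<in>\<rat>. u x < q \<longleftrightarrow> u y < q)"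
    unfolding constant_along_def using real_eq_if_same_rats_above
    by (intro AE_cong) (metis (lifting))
  also have "\<dots> \<longleftrightarrow> (AE x in m. \<forall>q\<in>\<rat>. AE y in K x. u x < q \<longleftrightarrow> u y < q)"
    by (simp add: AE_ball_countable countable_rat)
  also have "\<dots> \<longleftrightarrow> (AE x in m. \<forall>q\<in>\<rat>. (x \<in> ?A q \<longrightarrow> emeasure (K x) (?B q) = 0) \<and>
      (x \<in> ?B q \<longrightarrow> emeasure (K x) (?A q) = 0))"
  proof (intro AE_cong ball_cong refl)
    fix x q assume "x \<in> space m"
    then show "(AE y in K x. u x < q \<longleftrightarrow> u y < q) \<longleftrightarrow>
        (x \<in> ?A q \<longrightarrow> emeasure (K x) (?B q) = 0) \<and> (x \<in> ?B q \<longrightarrow> emeasure (K x) (?A q) = 0)"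
      by (cases "u x < q") (auto simp: null space_kernel simp del: not_less intro!: AE_cong)
  qed
  also have "\<dots> \<longleftrightarrow> (\<forall>q\<in>\<rat>. unlinked m K (?A q) (?B q) \<and> unlinked m K (?B q) (?A q))"
    by (simp add: AE_ball_countable countable_rat unlinked_def)
  finally show ?thesis .
qed

end

section \<open>From truncation levels to the level set property\<close>

lemma tails_integrable_uminus: "tails_integrable m u \<Longrightarrow> tails_integrable m (\<lambda>x. - u x)"
  by (simp add: tails_integrable_def)

text \<open>Only positive levels are available, as tails are controlled only for
  \<open>c > 0\<close>; values below 0 are separated by positive levels of the negated numbers.
  Density of the rationals absorbs the mismatch of strict and weak inequalities.\<close>

lemma real_eq_if_levels:
  fixes s t :: real
  assumes le: "\<And>c. c \<in> \<rat> \<Longrightarrow> 0 < c \<Longrightarrow> s \<le> c \<Longrightarrow> t \<le> c"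
    and ge: "\<And>c. c \<in> \<rat> \<Longrightarrow> 0 < c \<Longrightarrow> c < s \<Longrightarrow> c \<le> t"
    and le': "\<And>c. c \<in> \<rat> \<Longrightarrow> 0 < c \<Longrightarrow> - s \<le> c \<Longrightarrow> - t \<le> c"
    and ge': "\<And>c. c \<in> \<rat> \<Longrightarrow> 0 < c \<Longrightarrow> c < - s \<Longrightarrow> c \<le> - t"
  shows "t = s"
proof (rule ccontr)
  assume "t \<noteq> s"
  then consider "s < t" "0 < t" | "s < t" "t \<le> 0" | "t < s" "0 < s" | "t < s" "s \<le> 0"
    by linarith
  then show False
  proof cases
    case 1
    then obtain c where "c \<in> \<rat>" "max s 0 < c" "c < t"
      using Rats_dense_in_real[of "max s 0" t] by auto
    then show False using le[of c] by auto
  next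
    case 2
    then obtain c where "c \<in> \<rat>" "- t < c" "c < - s"
      using Rats_dense_in_real[of "- t" "- s"] by auto
    then show False using ge'[of c] 2 by auto
  next
    case 3
    then obtain c where "c \<in> \<rat>" "max t 0 < c" "c < s"
      using Rats_dense_in_real[of "max t 0" s] by auto
    then show False using ge[of c] by auto
  next
    case 4
    then obtain c where "c \<in> \<rat>" "- s < c" "c < - t"
      using Rats_dense_in_real[of "- s" "- t"] by auto
    then show False using le'[of c] 4 by auto
  qed
qed

context kernel_sub_invariant
begin

text \<open>Equality in Jensen's inequality is used for \<open>u\<close> and for its negative, at
  all positive rational levels. The mass statement follows because a nonzero \<open>u x\<close>
  exceeds some such level in absolute value, where equality forces full mass
  \<open>h x\<close>.\<close>

lemma constant_along_if_jensen_eq: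
  assumes u: "tails_integrable m u"
    and hm: "h \<in> borel_measurable m"
    and h: "AE x in m. measure (K x) (space m) \<le> h x" "\<And>x. x \<in> space m \<Longrightarrow> h x \<le> 1 / \<alpha>"
    and eq: "AE x in m. kernel_op K u x = u x * h x"
    and le: "\<And>v c. tails_integrable m v \<Longrightarrow> AE x in m. kernel_op K v x = v x * h x \<Longrightarrow>
      v \<in> {u, \<lambda>x. - u x} \<Longrightarrow> 0 < c \<Longrightarrow>
      (\<integral>\<^sup>+x. \<integral>\<^sup>+y. ennreal (v y - c) \<partial>K x \<partial>m) \<le> (\<integral>\<^sup>+x. ennreal (h x * (v x - c)) \<partial>m)"
  shows "constant_along m K u" and "AE x in m. u x \<noteq> 0 \<longrightarrow> measure (K x) (space m) = h x"
proof -
  let ?R = "\<rat> \<inter> {0<..} :: real set"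
  have R: "countable ?R" by (intro countable_Int1 countable_rat)
  have levels: "AE x in m. \<forall>c\<in>?R. if v x \<le> c then AE y in K x. v y \<le> c
     else (AE y in K x. c \<le> v y) \<and> measure (K x) (space m) = h x"
    if "v \<in> {u, \<lambda>x. - u x}" for v
  proof -
    have v: "tails_integrable m v" using that u tails_integrable_uminus[OF u] by auto
    have "AE x in m. kernel_op K v x = v x * h x"
      using that eq by (auto simp: kernel_op_def)
    then show ?thesis
      using that v hm h le unfolding AE_ball_countable[OF R]
      by (intro ballI AE_truncated_jensen_eq) auto
  qed
  from levels[of u, OF insertI1] levels[of "\<lambda>x. - u x", OF insertI2[OF singletonI]]
  have "AE x in m. (AE y in K x. u y = u x) \<and> (u x \<noteq> 0 \<longrightarrow> measure (K x) (space m) = h x)"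
  proof eventually_elim
    case (elim x)
    have 1: "AE y in K x. \<forall>c\<in>?R. (u x \<le> c \<longrightarrow> u y \<le> c) \<and> (c < u x \<longrightarrow> c \<le> u y)"
      unfolding AE_ball_countable[OF R]
    proof
      fix c assume "c \<in> ?R"
      with elim(1) show "AE y in K x. (u x \<le> c \<longrightarrow> u y \<le> c) \<and> (c < u x \<longrightarrow> c \<le> u y)"
        by (cases "u x \<le> c") fastforce+
    qed
    have 2: "AE y in K x. \<forall>c\<in>?R. (- u x \<le> c \<longrightarrow> - u y \<le> c) \<and> (c < - u x \<longrightarrow> c \<le> - u y)"
      unfolding AE_ball_countable[OF R]
    proof
      fix c assume "c \<in> ?R"
      with elim(2) show "AE y in K x. (- u x \<le> c \<longrightarrow> - u y \<le> c) \<and> (c < - u x \<longrightarrow> c \<le> - u y)"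
        by (cases "- u x \<le> c") fastforce+
    qed
    from 1 2 have "AE y in K x. u y = u x"
      by eventually_elim (rule real_eq_if_levels, auto)
    moreover have "measure (K x) (space m) = h x" if nz: "u x \<noteq> 0"
    proof -
      obtain c where "c \<in> ?R" "c < \<bar>u x\<bar>"
        using Rats_dense_in_real[of 0 "\<bar>u x\<bar>"] nz by auto
      then show ?thesis using elim(1)[rule_format, of c] elim(2)[rule_format, of c]
        by (auto split: if_splits)
    qed
    ultimately show ?case by simp
  qed
  then show "constant_along m K u" "AE x in m. u x \<noteq> 0 \<longrightarrow> measure (K x) (space m) = h x"
    unfolding constant_along_def by (eventually_elim, simp)+
qed

text \<open>With \<open>h = 1 / \<alpha>\<close>, the largest mass allowed, sub-invariance of the
  truncations is exactly the integrated inequality that the equality case asks for. The two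
  conditions on the right can be transferred separately to other parameters, to the adjoint and to
  combinations of functions.\<close>

lemma harmonic_iff:
  assumes u: "tails_integrable m u"
  shows "(AE x in m. \<alpha> * kernel_op K u x = u x) \<longleftrightarrow>
    constant_along m K u \<and> (AE x in m. u x \<noteq> 0 \<longrightarrow> \<alpha> * measure (K x) (space m) = 1)"
    (is "?H \<longleftrightarrow> _")
proof (intro iffI)
  assume ?H
  then have eq: "AE x in m. kernel_op K u x = u x * (1 / \<alpha>)"
    by eventually_elim (use pos in \<open>simp add: field_simps\<close>)
  have le: "(\<integral>\<^sup>+x. \<integral>\<^sup>+y. ennreal (v y - c) \<partial>K x \<partial>m) \<le> (\<integral>\<^sup>+x. ennreal (1 / \<alpha> * (v x - c)) \<partial>m)"
    if "tails_integrable m v" for v c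
  proof -
    have [measurable]: "v \<in> borel_measurable m" using that by (simp add: tails_integrable_def)
    have "(\<integral>\<^sup>+x. \<integral>\<^sup>+y. ennreal (v y - c) \<partial>K x \<partial>m)
        = ennreal (1 / \<alpha>) * (ennreal \<alpha> * (\<integral>\<^sup>+x. \<integral>\<^sup>+y. ennreal (v y - c) \<partial>K x \<partial>m))"
      using pos by (simp add: mult.assoc[symmetric] ennreal_mult[symmetric])
    also have "\<dots> \<le> ennreal (1 / \<alpha>) * (\<integral>\<^sup>+x. ennreal (v x - c) \<partial>m)"
      by (intro mult_left_mono sub_invariant) auto
    also have "\<dots> = (\<integral>\<^sup>+x. ennreal (1 / \<alpha> * (v x - c)) \<partial>m)"
      using pos by (subst ennreal_mult') (auto simp: nn_integral_cmult)
    finally show ?thesis .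
  qed
  have "constant_along m K u"
    "AE x in m. u x \<noteq> 0 \<longrightarrow> measure (K x) (space m) = 1 / \<alpha>"
    by (rule constant_along_if_jensen_eq[where h = "\<lambda>_. 1 / \<alpha>"];
        use u eq le measure_le in \<open>auto intro!: AE_I2\<close>)+
  then show "constant_along m K u \<and> (AE x in m. u x \<noteq> 0 \<longrightarrow> \<alpha> * measure (K x) (space m) = 1)"
    using pos by (auto elim!: eventually_mono)
next
  assume R: "constant_along m K u \<and> (AE x in m. u x \<noteq> 0 \<longrightarrow> \<alpha> * measure (K x) (space m) = 1)"
  have "AE x in m. kernel_op K (\<lambda>y. u y * 1) x = u x * kernel_op K (\<lambda>_. 1) x"
    using R u by (intro kernel_op_constant_along) (auto simp: tails_integrable_def)
  then show ?H using conjunct2[OF R] AE_space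
    by eventually_elim (auto simp: kernel_op_one mult.left_commute)
qed

text \<open>Testing with the indicator of \<open>?B a b\<close> makes the integrand bounded and says
  that \<open>u x\<close> times the mass of this set is the integral of \<open>u\<close> over it. So
  either the set has no mass under \<open>K x\<close> or \<open>u x\<close> lies between
  \<open>a\<close> and \<open>b\<close>. Rational endpoints keep the exceptional sets countable in
  number.\<close>

lemma constant_along_if_integral_eq:
  assumes [measurable]: "u \<in> borel_measurable m"
    and eq: "\<And>f. f \<in> bounded_pos_measurable m \<Longrightarrow>
      AE x in m. kernel_op K (\<lambda>y. u y * f y) x = u x * kernel_op K f x"
  shows "constant_along m K u"
proof -
  let ?B = "\<lambda>a b. {x\<in>space m. a \<le> u x \<and> u x < b}"
  \<comment> \<open>Averaging yields only the weak bound \<open>u x \<le> b\<close>; it suffices,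
    because \<open>b\<close> can be chosen strictly between \<open>u y\<close> and
    \<open>u x\<close>.\<close>
  have step: "AE x in m. AE y in K x. a \<le> u y \<and> u y < b \<longrightarrow> a \<le> u x \<and> u x \<le> b" for a b
  proof -
    have [measurable]: "?B a b \<in> sets m" by measurable
    have "(indicator (?B a b) :: _ \<Rightarrow> real) \<in> bounded_pos_measurable m"
      by (auto simp: bounded_pos_measurable_def indicator_def intro!: exI[of _ 1])
    from eq[OF this] show ?thesis using AE_space
    proof eventually_elim
      case (elim x)
      note [measurable_cong] = sets_kernel[OF elim(2)]
      interpret finite_measure "K x" using elim by (intro finite_kernel)
      let ?\<mu> = "measure (K x) (?B a b)"
      have E: "(\<integral>y. u y * indicator (?B a b) y \<partial>K x) = u x * ?\<mu>"
        using elim by (simp add: kernel_op_def space_kernel Int_absorb2)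
      have int: "integrable (K x) (\<lambda>y. u y * indicator (?B a b) y)"
        by (intro integrable_const_bound[where B = "\<bar>a\<bar> + \<bar>b\<bar>"])
           (auto simp: indicator_def)
      have int1: "integrable (K x) (\<lambda>y. indicator (?B a b) y :: real)"
        by (intro integrable_const_bound[where B = 1]) (auto simp: indicator_def)
      have "(\<integral>y. a * indicator (?B a b) y \<partial>K x) \<le> (\<integral>y. u y * indicator (?B a b) y \<partial>K x)"
        using int int1 by (intro integral_mono integrable_mult_right) (auto split: split_indicator)
      then have 1: "a * ?\<mu> \<le> u x * ?\<mu>"
        using E elim by (simp add: space_kernel Int_absorb2)
      have "(\<integral>y. u y * indicator (?B a b) y \<partial>K x) \<le> (\<integral>y. b * indicator (?B a b) y \<partial>K x)"
        using int int1 by (intro integral_mono integrable_mult_right) (auto split: split_indicator)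
      then have 2: "u x * ?\<mu> \<le> b * ?\<mu>"
        using E elim by (simp add: space_kernel Int_absorb2)
      show ?case
      proof (cases "?\<mu> = 0")
        case True
        then have "emeasure (K x) (?B a b) = 0" by (simp add: emeasure_eq_measure)
        then show ?thesis using elim
          by (intro AE_I[of _ _ "?B a b"]) (auto simp: space_kernel)
      next
        case False
        then have "0 < ?\<mu>" using measure_nonneg[of "K x" "?B a b"] by linarith
        with 1 2 show ?thesis by auto
      qed
    qed
  qed
  then have "AE x in m. \<forall>a\<in>\<rat>. \<forall>b\<in>\<rat>. AE y in K x. a \<le> u y \<and> u y < b \<longrightarrow> a \<le> u x \<and> u x \<le> b"
    by (simp add: AE_ball_countable countable_rat)
  then show ?thesis unfolding constant_along_def
  proof eventually_elim
    case (elim x)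
    then have "AE y in K x. \<forall>a\<in>\<rat>. \<forall>b\<in>\<rat>. a \<le> u y \<and> u y < b \<longrightarrow> a \<le> u x \<and> u x \<le> b"
      by (simp add: AE_ball_countable countable_rat)
    then show ?case
    proof eventually_elim
      case (elim y)
      show ?case
      proof (rule ccontr)
        assume "u y \<noteq> u x"
        then consider "u x < u y" | "u y < u x" by linarith
        then show False
        proof cases
          case 1
          obtain a where "a \<in> \<rat>" "u x < a" "a < u y" using Rats_dense_in_real[OF 1] by auto
          moreover obtain b where "b \<in> \<rat>" "u y < b"
            using Rats_dense_in_real[of "u y" "u y + 1"] by auto
          ultimately show False using elim[rule_format, of a b] by auto
        next
          case 2
          obtain b where "b \<in> \<rat>" "u y < b" "b < u x" using Rats_dense_in_real[OF 2] by auto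
          moreover obtain a where "a \<in> \<rat>" "a < u y"
            using Rats_dense_in_real[of "u y - 1" "u y"] by auto
          ultimately show False using elim[rule_format, of a b] by auto
        qed
      qed
    qed
  qed
qed

end

section \<open>Pairs of kernels in duality\<close>

locale dual_kernels =
  fixes m :: "'a measure" and K L :: "'a \<Rightarrow> 'a measure" and \<alpha> :: real
  assumes pos: "0 < \<alpha>"
    and kernels: "kernel_on m K" "kernel_on m L"
    and mass: "x \<in> space m \<Longrightarrow> ennreal \<alpha> * (\<integral>\<^sup>+y. 1 \<partial>K x) \<le> 1"
      "x \<in> space m \<Longrightarrow> ennreal \<alpha> * (\<integral>\<^sup>+y. 1 \<partial>L x) \<le> 1"
    and dual: "f \<in> borel_measurable m \<Longrightarrow> g \<in> borel_measurable m \<Longrightarrow>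
      (\<integral>\<^sup>+x. f x * (\<integral>\<^sup>+y. g y \<partial>K x) \<partial>m) = (\<integral>\<^sup>+x. g x * (\<integral>\<^sup>+y. f y \<partial>L x) \<partial>m)"

lemma dual_kernels_swap: "dual_kernels m K L \<alpha> \<Longrightarrow> dual_kernels m L K \<alpha>"
  unfolding dual_kernels_def by (simp add: eq_commute)

text \<open>Duality against the constant 1 moves \<open>K\<close> from \<open>g\<close> to the mass
  of \<open>L\<close>, and this mass is at most \<open>1 / \<alpha>\<close>.\<close>

lemma (in dual_kernels) kernel_sub_invariant: "kernel_sub_invariant m K \<alpha>"
proof
  fix g :: "'a \<Rightarrow> ennreal" assume [measurable]: "g \<in> borel_measurable m"
  have "ennreal \<alpha> * (\<integral>\<^sup>+x. \<integral>\<^sup>+y. g y \<partial>K x \<partial>m) = ennreal \<alpha> * (\<integral>\<^sup>+x. g x * (\<integral>\<^sup>+y. 1 \<partial>L x) \<partial>m)"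
    using dual[of "\<lambda>_. 1" g] by simp
  also have "\<dots> = (\<integral>\<^sup>+x. ennreal \<alpha> * (g x * (\<integral>\<^sup>+y. 1 \<partial>L x)) \<partial>m)"
  proof (intro nn_integral_cmult[symmetric] borel_measurable_times_ennreal)
    have "(\<lambda>x. emeasure (L x) (space m)) \<in> borel_measurable m"
      using kernels by (auto simp: kernel_on_def)
    moreover have "(\<integral>\<^sup>+y. 1 \<partial>L x) = emeasure (L x) (space m)" if "x \<in> space m" for x
      using kernels that sets_eq_imp_space_eq[of "L x" m] by (simp add: kernel_on_def)
    ultimately show "(\<lambda>x. \<integral>\<^sup>+y. 1 \<partial>L x) \<in> borel_measurable m" by (simp cong: measurable_cong)
  qed simp
  also have "\<dots> \<le> (\<integral>\<^sup>+x. g x \<partial>m)"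
  proof (intro nn_integral_mono)
    fix x assume "x \<in> space m"
    then have "g x * (ennreal \<alpha> * (\<integral>\<^sup>+y. 1 \<partial>L x)) \<le> g x * 1" by (intro mult_left_mono mass) auto
    then show "ennreal \<alpha> * (g x * (\<integral>\<^sup>+y. 1 \<partial>L x)) \<le> g x" by (simp add: mult_ac)
  qed
  finally show "ennreal \<alpha> * (\<integral>\<^sup>+x. \<integral>\<^sup>+y. g y \<partial>K x \<partial>m) \<le> (\<integral>\<^sup>+x. g x \<partial>m)" .
qed (use pos kernels mass in auto)

sublocale dual_kernels \<subseteq> K: kernel_sub_invariant m K \<alpha>
  by (rule kernel_sub_invariant)

sublocale dual_kernels \<subseteq> L: kernel_sub_invariant m L \<alpha>
  by (rule dual_kernels.kernel_sub_invariant[OF dual_kernels_swap]) unfold_locales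

context dual_kernels
begin

text \<open>Both sides say that one and the same double integral, of the two indicators against the
  kernel, vanishes.\<close>

lemma unlinked_dual:
  assumes [measurable]: "A \<in> sets m" "B \<in> sets m"
  shows "unlinked m K A B \<longleftrightarrow> unlinked m L B A"
proof -
  have "unlinked m K A B \<longleftrightarrow> (\<integral>\<^sup>+x. indicator A x * (\<integral>\<^sup>+y. indicator B y \<partial>K x) \<partial>m) = 0"
    unfolding unlinked_def by (subst nn_integral_0_iff_AE)
      (auto simp: indicator_def K.sets_kernel intro!: AE_cong)
  also have "\<dots> \<longleftrightarrow> (\<integral>\<^sup>+x. indicator B x * (\<integral>\<^sup>+y. indicator A y \<partial>L x) \<partial>m) = 0"
    by (simp add: dual)
  also have "\<dots> \<longleftrightarrow> unlinked m L B A"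
    unfolding unlinked_def by (subst nn_integral_0_iff_AE)
      (auto simp: indicator_def L.sets_kernel intro!: AE_cong)
  finally show ?thesis .
qed

text \<open>Duality exchanges the two conditions attached to a sublevel set and its complement, so
  their conjunction is self-dual.\<close>

lemma constant_along_dual:
  assumes [measurable]: "u \<in> borel_measurable m"
  shows "constant_along m K u \<longleftrightarrow> constant_along m L u"
proof -
  have [measurable]: "{x\<in>space m. u x < q} \<in> sets m" for q by measurable
  show ?thesis
    unfolding K.constant_along_iff_unlinked[OF assms] L.constant_along_iff_unlinked[OF assms]
    by (auto simp: unlinked_dual)
qed

text \<open>Write w for the positive part of v - c. Duality, Jensen for \<open>L\<close>, and
  duality again give: integral of K w = integral of w L1 \<le> integral of L w = integral of w K1.
  This is the reverse of the integrated Jensen inequality for \<open>K\<close> with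
  \<open>h = K1\<close>, so equality holds there.\<close>

lemma constant_along_if_kernel_op_eq:
  assumes u: "tails_integrable m u"
    and eqK: "AE x in m. kernel_op K u x = u x * kernel_op K (\<lambda>_. 1) x"
    and eqL: "AE x in m. kernel_op L u x = u x * kernel_op L (\<lambda>_. 1) x"
  shows "constant_along m K u"
proof (rule K.constant_along_if_jensen_eq(1)[where h = "\<lambda>x. measure (K x) (space m)"])
  show "AE x in m. kernel_op K u x = u x * measure (K x) (space m)"
    using eqK AE_space by eventually_elim (simp add: K.kernel_op_one)
  fix v and c :: real
  assume v: "tails_integrable m v" "v \<in> {u, \<lambda>x. - u x}" and c: "0 < c"
  have [measurable]: "v \<in> borel_measurable m" using v by (simp add: tails_integrable_def)
  have "AE x in m. kernel_op L v x = v x * measure (L x) (space m)"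
    using eqL AE_space by eventually_elim (use v in \<open>auto simp: L.kernel_op_one[symmetric] kernel_op_def\<close>)
  from L.AE_truncated_jensen[OF v(1) less_imp_le[OF c] _ this]
  have J: "AE x in m. ennreal (measure (L x) (space m) * (v x - c)) \<le> (\<integral>\<^sup>+y. ennreal (v y - c) \<partial>L x)"
    by simp
  have "(\<integral>\<^sup>+x. \<integral>\<^sup>+y. ennreal (v y - c) \<partial>K x \<partial>m) = (\<integral>\<^sup>+x. ennreal (v x - c) * (\<integral>\<^sup>+y. 1 \<partial>L x) \<partial>m)"
    using dual[of "\<lambda>_. 1" "\<lambda>y. ennreal (v y - c)"] by simp
  also have "\<dots> = (\<integral>\<^sup>+x. ennreal (measure (L x) (space m) * (v x - c)) \<partial>m)"
    by (intro nn_integral_cong, subst ennreal_mult')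
       (simp_all add: L.ennreal_mass mult.commute del: nn_integral_const)
  also have "\<dots> \<le> (\<integral>\<^sup>+x. \<integral>\<^sup>+y. ennreal (v y - c) \<partial>L x \<partial>m)"
    using J by (rule nn_integral_mono_AE)
  also have "\<dots> = (\<integral>\<^sup>+x. ennreal (v x - c) * (\<integral>\<^sup>+y. 1 \<partial>K x) \<partial>m)"
    using dual[of "\<lambda>y. ennreal (v y - c)" "\<lambda>_. 1"] by simp
  also have "\<dots> = (\<integral>\<^sup>+x. ennreal (measure (K x) (space m) * (v x - c)) \<partial>m)"
    by (intro nn_integral_cong, subst ennreal_mult')
       (simp_all add: K.ennreal_mass mult.commute del: nn_integral_const)
  finally show "(\<integral>\<^sup>+x. \<integral>\<^sup>+y. ennreal (v y - c) \<partial>K x \<partial>m)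
      \<le> (\<integral>\<^sup>+x. ennreal (measure (K x) (space m) * (v x - c)) \<partial>m)" .
qed (use u K.measure_le in auto)

text \<open>Let A be a set where |u| exceeds c > 0. As K1_A = 1_A K1, duality gives m(A) = integral
  of \<alpha> K1_A = integral over A of \<alpha> L1. Since \<alpha> L1 \<le> 1 and m(A) is finite,
  \<alpha> L1 = 1 almost everywhere on A.\<close>

lemma mass_one_dual:
  assumes u: "tails_integrable m u" and const: "constant_along m K u"
    and one: "AE x in m. u x \<noteq> 0 \<longrightarrow> \<alpha> * measure (K x) (space m) = 1"
  shows "AE x in m. u x \<noteq> 0 \<longrightarrow> \<alpha> * measure (L x) (space m) = 1"
proof -
  have [measurable]: "u \<in> borel_measurable m" using u by (simp add: tails_integrable_def)
  have level: "AE x in m. c < \<bar>u x\<bar> \<longrightarrow> \<alpha> * measure (L x) (space m) = 1" if c: "0 < c" for c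
  proof -
    define A where "A = {x\<in>space m. c < \<bar>u x\<bar>}"
    have A[measurable]: "A \<in> sets m" unfolding A_def by measurable
    have "emeasure m A = (\<integral>\<^sup>+x. indicator A x \<partial>m)" by simp
    \<comment> \<open>A Chebyshev bound at half the level: on \<open>A\<close> the excess of
      \<open>\<bar>u x\<bar>\<close> over \<open>c / 2\<close> is more than
      \<open>c / 2\<close>.\<close>
    also have "\<dots> \<le> (\<integral>\<^sup>+x. ennreal (2 / c) * ennreal (\<bar>u x\<bar> - c / 2) \<partial>m)"
    proof (intro nn_integral_mono)
      fix x
      show "indicator A x \<le> ennreal (2 / c) * ennreal (\<bar>u x\<bar> - c / 2)"
        using c by (auto simp: indicator_def A_def ennreal_mult'[symmetric] field_simps
            simp flip: ennreal_1 intro!: ennreal_leI)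
    qed
    also have "\<dots> = ennreal (2 / c) * (\<integral>\<^sup>+x. ennreal (\<bar>u x\<bar> - c / 2) \<partial>m)"
      by (intro nn_integral_cmult) auto
    also have "\<dots> < \<infinity>"
      using u c by (auto simp: tails_integrable_def ennreal_mult_less_top)
    finally have fin: "emeasure m A < \<infinity>" .
    let ?l = "\<lambda>x. ennreal (\<alpha> * measure (L x) (space m))"
    have l1: "?l x \<le> 1" if "x \<in> space m" for x
      using L.measure_le[OF that] pos
      by (simp add: pos_le_divide_eq mult.commute flip: ennreal_1)
    have "AE x in m. indicator A x * (ennreal \<alpha> * (\<integral>\<^sup>+y. 1 \<partial>K x)) = indicator A x"
      using one AE_space
    proof eventually_elim
      case (elim x)
      then show ?case using c pos unfolding K.ennreal_mass[OF elim(2)]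
        by (auto simp: indicator_def A_def simp flip: ennreal_mult)
    qed
    then have "emeasure m A = (\<integral>\<^sup>+x. indicator A x * (ennreal \<alpha> * (\<integral>\<^sup>+y. 1 \<partial>K x)) \<partial>m)"
      using A by (subst nn_integral_cong_AE) auto
    \<comment> \<open>\<open>A\<close> is a union of level sets of \<open>u\<close>, so its
      indicator is constant for almost all points seen by \<open>K x\<close> and leaves the inner
      integral.\<close>
    also have "\<dots> = (\<integral>\<^sup>+x. ennreal \<alpha> * (1 * (\<integral>\<^sup>+y. indicator A y \<partial>K x)) \<partial>m)"
    proof (rule nn_integral_cong_AE)
      show "AE x in m. indicator A x * (ennreal \<alpha> * (\<integral>\<^sup>+y. 1 \<partial>K x))
          = ennreal \<alpha> * (1 * (\<integral>\<^sup>+y. indicator A y \<partial>K x))"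
        using const AE_space unfolding constant_along_def
      proof eventually_elim
        case (elim x)
        have "AE y in K x. y \<in> space m"
          using AE_space[of "K x"] by (simp add: K.space_kernel elim)
        with elim(1) have "AE y in K x. (indicator A y :: ennreal) = indicator A x"
          by eventually_elim (use elim in \<open>auto simp: indicator_def A_def\<close>)
        then have "(\<integral>\<^sup>+y. indicator A y \<partial>K x) = (\<integral>\<^sup>+y. indicator A x * 1 \<partial>K x)"
          by (intro nn_integral_cong_AE) auto
        also have "\<dots> = indicator A x * (\<integral>\<^sup>+y. 1 \<partial>K x)"
          by (intro nn_integral_cmult) auto
        finally show ?case by (simp add: mult_ac)
      qed
    qed
    also have "\<dots> = ennreal \<alpha> * (\<integral>\<^sup>+x. 1 * (\<integral>\<^sup>+y. indicator A y \<partial>K x) \<partial>m)"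
      by (intro nn_integral_cmult) auto
    also have "\<dots> = ennreal \<alpha> * (\<integral>\<^sup>+x. indicator A x * (\<integral>\<^sup>+y. 1 \<partial>L x) \<partial>m)"
      by (subst dual) auto
    also have "\<dots> = (\<integral>\<^sup>+x. ennreal \<alpha> * (indicator A x * (\<integral>\<^sup>+y. 1 \<partial>L x)) \<partial>m)"
      by (intro nn_integral_cmult[symmetric]) auto
    also have "\<dots> = (\<integral>\<^sup>+x. indicator A x * ?l x \<partial>m)"
      using pos by (intro nn_integral_cong)
        (simp add: L.ennreal_mass ennreal_mult' mult_ac del: nn_integral_const)
    finally have m: "(\<integral>\<^sup>+x. indicator A x * ?l x \<partial>m) = emeasure m A" by simp
    have "(\<integral>\<^sup>+x. indicator A x - indicator A x * ?l x \<partial>m)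
        = (\<integral>\<^sup>+x. indicator A x \<partial>m) - (\<integral>\<^sup>+x. indicator A x * ?l x \<partial>m)"
      using m fin l1 by (intro nn_integral_diff) (auto simp: indicator_def)
    also have "\<dots> = 0" using m fin by (simp add: diff_eq_0_iff_ennreal)
    finally have "AE x in m. indicator A x - indicator A x * ?l x = 0"
      by (subst (asm) nn_integral_0_iff_AE) auto
    then show ?thesis using AE_space
    proof eventually_elim
      case (elim x)
      show ?case
      proof
        assume "c < \<bar>u x\<bar>"
        then have "1 - ?l x = 0" using elim by (simp add: A_def)
        then have "1 \<le> ?l x" by (rule ennreal_minus_eq_0)
        with l1[OF elim(2)] have "?l x = ennreal 1" by simp
        then show "\<alpha> * measure (L x) (space m) = 1"
          using pos by (subst (asm) ennreal_inj) auto
      qed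
    qed
  qed
  \<comment> \<open>Countably many levels exhaust the set where \<open>u\<close> is nonzero.\<close>
  have "AE x in m. \<forall>n. 1 / real (Suc n) < \<bar>u x\<bar> \<longrightarrow> \<alpha> * measure (L x) (space m) = 1"
    unfolding AE_all_countable using level by simp
  then show ?thesis
  proof eventually_elim
    case (elim x)
    show ?case
    proof
      assume "u x \<noteq> 0"
      then obtain n where "1 / real (Suc n) < \<bar>u x\<bar>" using nat_approx_posE[of "\<bar>u x\<bar>"] by auto
      with elim show "\<alpha> * measure (L x) (space m) = 1" by blast
    qed
  qed
qed

end

section \<open>Resolvents: change of parameter\<close>

lemma constant_along_combine:
  assumes "constant_along m K v" "constant_along m K w"
  shows "constant_along m K (\<lambda>x. h (v x) (w x))"
  using assms unfolding constant_along_def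
proof eventually_elim
  case (elim x)
  then show ?case by eventually_elim simp
qed

locale sub_invariant_resolvent =
  fixes m :: "'a measure" and U :: "real \<Rightarrow> 'a \<Rightarrow> 'a measure"
  assumes resolvent: "sub_markovian_resolvent m U"
    and sub_invariant_kernel: "0 < \<alpha> \<Longrightarrow> kernel_sub_invariant m (U \<alpha>) \<alpha>"
begin

lemma resolvent_eq:
  fixes f :: "'a \<Rightarrow> ennreal"
  assumes "0 < \<alpha>" "\<alpha> \<le> \<beta>" "f \<in> borel_measurable m" "x \<in> space m"
  shows "(\<integral>\<^sup>+y. f y \<partial>U \<alpha> x) =
      (\<integral>\<^sup>+y. f y \<partial>U \<beta> x) + ennreal (\<beta> - \<alpha>) * (\<integral>\<^sup>+y. (\<integral>\<^sup>+z. f z \<partial>U \<beta> y) \<partial>U \<alpha> x)"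
    "(\<integral>\<^sup>+y. f y \<partial>U \<alpha> x) =
      (\<integral>\<^sup>+y. f y \<partial>U \<beta> x) + ennreal (\<beta> - \<alpha>) * (\<integral>\<^sup>+y. (\<integral>\<^sup>+z. f z \<partial>U \<alpha> y) \<partial>U \<beta> x)"
  using resolvent assms unfolding sub_markovian_resolvent_def resolvent_equation_def by blast+

text \<open>Passing to a smaller parameter \<open>\<beta> < \<alpha>\<close> iterates the resolvent equation on \<open>A\<close>, which
  amounts to the Neumann series of \<open>U\<^sub>\<beta>\<close> in powers of \<open>(\<alpha> - \<beta>) U\<^sub>\<alpha>\<close>.\<close>
lemma unlinked_resolvent:
  assumes \<alpha>: "0 < \<alpha>" and \<beta>: "0 < \<beta>" and A[measurable]: "A \<in> sets m"
    and un: "unlinked m (U \<alpha>) A (space m - A)"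
  shows "unlinked m (U \<beta>) A (space m - A)"
proof -
  interpret a: kernel_sub_invariant m "U \<alpha>" \<alpha> by (rule sub_invariant_kernel[OF \<alpha>])
  interpret b: kernel_sub_invariant m "U \<beta>" \<beta> by (rule sub_invariant_kernel[OF \<beta>])
  define B where "B = space m - A"
  have B[measurable]: "B \<in> sets m" unfolding B_def by measurable
  have B_a: "(\<integral>\<^sup>+y. indicator B y \<partial>U \<alpha> x) = emeasure (U \<alpha> x) B" if "x \<in> space m" for x
    using that by (simp add: a.sets_kernel)
  have B_b: "(\<integral>\<^sup>+y. indicator B y \<partial>U \<beta> x) = emeasure (U \<beta> x) B" if "x \<in> space m" for x
    using that by (simp add: b.sets_kernel)
  have un': "AE x in m. x \<in> A \<longrightarrow> emeasure (U \<alpha> x) B = 0"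
    using un by (simp add: unlinked_def B_def)
  show ?thesis
  proof (cases "\<alpha> \<le> \<beta>")
    case True
    from un' AE_space show ?thesis unfolding unlinked_def B_def[symmetric]
    proof eventually_elim
      case (elim x)
      have "emeasure (U \<beta> x) B \<le> emeasure (U \<alpha> x) B"
        using resolvent_eq(1)[OF \<alpha> True, of "indicator B" x] elim by (simp add: B_a B_b)
      then show ?case using elim by auto
    qed
  next
    case False
    \<comment> \<open>\<open>r\<close> bounds the mass of \<alpha> - \<beta> times the kernel
      \<open>U \<alpha> x\<close>, so each use of the resolvent equation gains this factor.\<close>
    define r where "r = (\<alpha> - \<beta>) / \<alpha>"
    have r: "0 \<le> r" "r < 1" using False \<alpha> \<beta> by (auto simp: r_def field_simps)
    have bound: "AE x in m. x \<in> A \<longrightarrow> emeasure (U \<beta> x) B \<le> ennreal (r ^ n / \<beta>)" for n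
    proof (induction n)
      case 0
      show ?case
      proof (rule AE_I2, rule impI)
        fix x assume x: "x \<in> space m"
        have "emeasure (U \<beta> x) B \<le> (\<integral>\<^sup>+y. 1 \<partial>U \<beta> x)"
          using x by (auto simp: b.space_kernel b.sets_kernel B_def intro!: emeasure_mono)
        also have "\<dots> \<le> ennreal (1 / \<beta>)"
          unfolding b.ennreal_mass[OF x] by (intro ennreal_leI b.measure_le x)
        finally show "emeasure (U \<beta> x) B \<le> ennreal (r ^ 0 / \<beta>)" by simp
      qed
    next
      case (Suc n)
      \<comment> \<open>The induction bound holds only \<open>m\<close>-almost everywhere on
        \<open>A\<close>. \<open>AE_kernel\<close> makes it available for
        \<open>U \<alpha> x\<close>-almost all points, and by \<open>un'\<close> these lie in
        \<open>A\<close> when \<open>x\<close> does.\<close>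
      from a.AE_kernel[OF Suc.IH] un' AE_space show ?case
      proof eventually_elim
        case (elim x)
        show ?case
        proof
          assume x: "x \<in> A"
          have "AE y in U \<alpha> x. y \<in> A"
            using elim x by (intro AE_I[of _ _ B]) (auto simp: a.space_kernel a.sets_kernel B_def)
          with elim(1) have "AE y in U \<alpha> x. emeasure (U \<beta> y) B \<le> ennreal (r ^ n / \<beta>) * 1"
            by eventually_elim simp
          then have "(\<integral>\<^sup>+y. emeasure (U \<beta> y) B \<partial>U \<alpha> x) \<le> (\<integral>\<^sup>+y. ennreal (r ^ n / \<beta>) * 1 \<partial>U \<alpha> x)"
            by (rule nn_integral_mono_AE)
          also have "\<dots> = ennreal (r ^ n / \<beta>) * (\<integral>\<^sup>+y. 1 \<partial>U \<alpha> x)"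
            by (intro nn_integral_cmult) auto
          also have "\<dots> \<le> ennreal (r ^ n / \<beta>) * ennreal (1 / \<alpha>)"
            unfolding a.ennreal_mass[OF elim(3)]
            by (intro mult_left_mono ennreal_leI a.measure_le elim) auto
          finally have I: "(\<integral>\<^sup>+y. emeasure (U \<beta> y) B \<partial>U \<alpha> x) \<le> ennreal (r ^ n / \<beta>) * ennreal (1 / \<alpha>)" .
          have "emeasure (U \<beta> x) B
              = emeasure (U \<alpha> x) B + ennreal (\<alpha> - \<beta>) * (\<integral>\<^sup>+y. \<integral>\<^sup>+z. indicator B z \<partial>U \<beta> y \<partial>U \<alpha> x)"
            using resolvent_eq(2)[OF \<beta>, of \<alpha> "indicator B" x] False elim
            by (simp add: B_a B_b)
          also have "(\<integral>\<^sup>+y. \<integral>\<^sup>+z. indicator B z \<partial>U \<beta> y \<partial>U \<alpha> x) = (\<integral>\<^sup>+y. emeasure (U \<beta> y) B \<partial>U \<alpha> x)"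
            using elim by (intro nn_integral_cong B_b) (simp add: a.space_kernel)
          finally have "emeasure (U \<beta> x) B \<le> ennreal (\<alpha> - \<beta>) * (ennreal (r ^ n / \<beta>) * ennreal (1 / \<alpha>))"
            using x elim I by (simp add: mult_left_mono)
          also have "\<dots> = ennreal (r ^ Suc n / \<beta>)"
            using \<alpha> \<beta> r False by (simp add: ennreal_mult[symmetric] r_def[symmetric]) (simp add: r_def)
          finally show "emeasure (U \<beta> x) B \<le> ennreal (r ^ Suc n / \<beta>)" .
        qed
      qed
    qed
    have "AE x in m. \<forall>n. x \<in> A \<longrightarrow> emeasure (U \<beta> x) B \<le> ennreal (r ^ n / \<beta>)"
      unfolding AE_all_countable using bound by simp
    then show ?thesis unfolding unlinked_def B_def[symmetric]
    proof eventually_elim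
      case (elim x)
      show ?case
      proof
        assume "x \<in> A"
        have "(\<lambda>n. r ^ n / \<beta>) \<longlonglongrightarrow> 0 / \<beta>"
          using r by (intro tendsto_divide LIMSEQ_power_zero tendsto_const) (use \<beta> in auto)
        then have "(\<lambda>n. ennreal (r ^ n / \<beta>)) \<longlonglongrightarrow> ennreal 0" by (intro tendsto_ennrealI) simp
        then have "emeasure (U \<beta> x) B \<le> ennreal 0"
          using elim \<open>x \<in> A\<close> by (intro LIMSEQ_le_const) auto
        then show "emeasure (U \<beta> x) B = 0" by simp
      qed
    qed
  qed
qed

text \<open>The set transfer for \<open>unlinked\<close> is applied to each rational sublevel set
  and to its complement.\<close>

lemma constant_along_resolvent:
  assumes u[measurable]: "u \<in> borel_measurable m" and \<alpha>: "0 < \<alpha>" and \<beta>: "0 < \<beta>"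
    and const: "constant_along m (U \<alpha>) u"
  shows "constant_along m (U \<beta>) u"
proof -
  interpret a: kernel_sub_invariant m "U \<alpha>" \<alpha> by (rule sub_invariant_kernel[OF \<alpha>])
  interpret b: kernel_sub_invariant m "U \<beta>" \<beta> by (rule sub_invariant_kernel[OF \<beta>])
  show ?thesis unfolding b.constant_along_iff_unlinked[OF u]
  proof (intro ballI conjI)
    fix q :: real assume "q \<in> \<rat>"
    let ?A = "{x\<in>space m. u x < q}"
    have A: "?A \<in> sets m" by measurable
    have un: "unlinked m (U \<alpha>) ?A (space m - ?A)" "unlinked m (U \<alpha>) (space m - ?A) ?A"
      using const[unfolded a.constant_along_iff_unlinked[OF u]] \<open>q \<in> \<rat>\<close> by auto
    have AA: "space m - (space m - ?A) = ?A" by auto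
    show "unlinked m (U \<beta>) ?A (space m - ?A)" by (rule unlinked_resolvent[OF \<alpha> \<beta> A un(1)])
    show "unlinked m (U \<beta>) (space m - ?A) ?A"
      using unlinked_resolvent[OF \<alpha> \<beta>, of "space m - ?A"] A un(2) unfolding AA by auto
  qed
qed

text \<open>For \<open>u x \<noteq> 0\<close>, \<open>U \<beta> x\<close> is carried by points with
  the same nonzero value of \<open>u\<close>, where the \<alpha>-mass is
  \<open>1 / \<alpha>\<close>. The resolvent equation for the constant 1 then becomes a linear
  equation for the \<beta>-mass.\<close>

lemma mass_one_resolvent:
  assumes u[measurable]: "u \<in> borel_measurable m" and \<alpha>: "0 < \<alpha>" and \<beta>: "0 < \<beta>"
    and const: "constant_along m (U \<alpha>) u"
    and one: "AE x in m. u x \<noteq> 0 \<longrightarrow> \<alpha> * measure (U \<alpha> x) (space m) = 1"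
  shows "AE x in m. u x \<noteq> 0 \<longrightarrow> \<beta> * measure (U \<beta> x) (space m) = 1"
proof -
  interpret a: kernel_sub_invariant m "U \<alpha>" \<alpha> by (rule sub_invariant_kernel[OF \<alpha>])
  interpret b: kernel_sub_invariant m "U \<beta>" \<beta> by (rule sub_invariant_kernel[OF \<beta>])
  have "constant_along m (U \<beta>) u" by (rule constant_along_resolvent[OF u \<alpha> \<beta> const])
  then show ?thesis
    using b.AE_kernel[OF one] one AE_space unfolding constant_along_def
  proof eventually_elim
    case (elim x)
    show ?case
    proof
      assume x: "u x \<noteq> 0"
      let ?a = "measure (U \<alpha> x) (space m)" and ?b = "measure (U \<beta> x) (space m)"
      have a: "?a = 1 / \<alpha>" using elim(3) x \<alpha> by (simp add: field_simps)
      have sp: "AE y in U \<beta> x. y \<in> space m"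
        using AE_space[of "U \<beta> x"] by (simp add: b.space_kernel elim)
      have "(\<integral>\<^sup>+y. (\<integral>\<^sup>+z. 1 \<partial>U \<alpha> y) \<partial>U \<beta> x) = (\<integral>\<^sup>+y. ennreal (1 / \<alpha>) * 1 \<partial>U \<beta> x)"
      proof (rule nn_integral_cong_AE)
        show "AE y in U \<beta> x. (\<integral>\<^sup>+z. 1 \<partial>U \<alpha> y) = ennreal (1 / \<alpha>) * 1"
          using elim(1,2) sp
        proof eventually_elim
          case (elim y)
          then have "measure (U \<alpha> y) (space m) = 1 / \<alpha>" using x \<alpha> by (simp add: field_simps)
          then show ?case using a.ennreal_mass[OF elim(3)] by simp
        qed
      qed
      also have "\<dots> = ennreal (1 / \<alpha>) * (\<integral>\<^sup>+y. 1 \<partial>U \<beta> x)"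
        by (intro nn_integral_cmult) auto
      finally have I: "(\<integral>\<^sup>+y. (\<integral>\<^sup>+z. 1 \<partial>U \<alpha> y) \<partial>U \<beta> x) = ennreal (?b / \<alpha>)"
        unfolding b.ennreal_mass[OF elim(4)] using \<alpha> by (simp add: ennreal_mult[symmetric])
      \<comment> \<open>The resolvent equation is additive with ordered parameters. In each case the
        composition with \<open>U \<beta>\<close> outside and \<open>U \<alpha>\<close> inside is
        the one evaluated in \<open>I\<close>.\<close>
      consider "\<alpha> \<le> \<beta>" | "\<beta> \<le> \<alpha>" by linarith
      then have "?b * \<beta> / \<alpha> = 1 / \<alpha>"
      proof cases
        case 1
        have "ennreal ?a = ennreal ?b + ennreal (\<beta> - \<alpha>) * ennreal (?b / \<alpha>)"
          using resolvent_eq(2)[OF \<alpha> 1, of "\<lambda>_. 1" x] elim(4)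
          unfolding I a.ennreal_mass[OF elim(4)] b.ennreal_mass[OF elim(4)] by simp
        also have "\<dots> = ennreal (?b + (\<beta> - \<alpha>) * (?b / \<alpha>))"
          using 1 \<alpha> by (simp add: ennreal_plus ennreal_mult' del: times_divide_eq_right)
        finally have "?a = ?b + (\<beta> - \<alpha>) * (?b / \<alpha>)"
          using 1 \<alpha> by (subst (asm) ennreal_inj) auto
        then show ?thesis using a \<alpha> by (simp add: field_simps)
      next
        case 2
        have "ennreal ?b = ennreal ?a + ennreal (\<alpha> - \<beta>) * ennreal (?b / \<alpha>)"
          using resolvent_eq(1)[OF \<beta> 2, of "\<lambda>_. 1" x] elim(4)
          unfolding I a.ennreal_mass[OF elim(4)] b.ennreal_mass[OF elim(4)] by simp
        also have "\<dots> = ennreal (?a + (\<alpha> - \<beta>) * (?b / \<alpha>))"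
          using 2 \<alpha> by (simp add: ennreal_plus ennreal_mult' del: times_divide_eq_right)
        finally have "?b = ?a + (\<alpha> - \<beta>) * (?b / \<alpha>)"
          using 2 \<alpha> by (subst (asm) ennreal_inj) auto
        then show ?thesis using a \<alpha> by (simp add: field_simps)
      qed
      then show "\<beta> * ?b = 1" using \<alpha> by (simp add: field_simps)
    qed
  qed
qed

lemma harmonic_resolvent:
  assumes u: "tails_integrable m u" and \<alpha>: "0 < \<alpha>" and \<beta>: "0 < \<beta>"
    and H: "AE x in m. \<alpha> * kernel_op (U \<alpha>) u x = u x"
  shows "AE x in m. \<beta> * kernel_op (U \<beta>) u x = u x"
proof -
  have um: "u \<in> borel_measurable m" using u by (simp add: tails_integrable_def)
  show ?thesis
    using H constant_along_resolvent[OF um \<alpha> \<beta>] mass_one_resolvent[OF um \<alpha> \<beta>]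
    unfolding kernel_sub_invariant.harmonic_iff[OF sub_invariant_kernel[OF \<alpha>] u]
      kernel_sub_invariant.harmonic_iff[OF sub_invariant_kernel[OF \<beta>] u] by blast
qed

section \<open>Invariant functions and the invariant sigma-algebra\<close>

lemma invariant_fun_iff_constant_along:
  assumes u: "u \<in> (\<Union>q\<in>{1..\<infinity>}. L_space q m)"
  shows "invariant_fun m U u \<longleftrightarrow> (\<forall>\<alpha>>0. constant_along m (U \<alpha>) u)"
proof -
  have um: "u \<in> borel_measurable m" using u by (auto simp: L_space_def)
  show ?thesis
  proof (intro iffI allI impI)
    fix \<alpha> :: real assume inv: "invariant_fun m U u" and \<alpha>: "0 < \<alpha>"
    show "constant_along m (U \<alpha>) u"
      using inv \<alpha> unfolding invariant_fun_def
      by (intro kernel_sub_invariant.constant_along_if_integral_eq[OF sub_invariant_kernel[OF \<alpha>] um]) blast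
  next
    assume const: "\<forall>\<alpha>>0. constant_along m (U \<alpha>) u"
    have "AE x in m. kernel_op (U \<alpha>) (\<lambda>y. u y * f y) x = u x * kernel_op (U \<alpha>) f x"
      if "0 < \<alpha>" "f \<in> bounded_pos_measurable m" for \<alpha> f
      using that const um
      by (intro kernel_sub_invariant.kernel_op_constant_along[OF sub_invariant_kernel])
         (auto simp: bounded_pos_measurable_def)
    then show "invariant_fun m U u" using u unfolding invariant_fun_def by blast
  qed
qed

text \<open>Measurability makes every sublevel set and its complement invariant, and invariance
  tested with 1 prevents transport into such a set from outside. Conversely, the indicator of a
  sublevel set is a function of \<open>u\<close>, hence also constant along the kernels, and it can
  be pulled out of the integral.\<close>

lemma measurable_invariant_iff_constant_along:
  assumes u[measurable]: "u \<in> borel_measurable m"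
  shows "u \<in> borel_measurable (invariant_sigma_algebra m U) \<longleftrightarrow>
    (\<forall>\<alpha>>0. constant_along m (U \<alpha>) u)"
proof -
  note sets = sets_invariant_sigma_algebra[OF resolvent]
  have space: "space (invariant_sigma_algebra m U) = space m"
    unfolding invariant_sigma_algebra_def by (rule space_measure_of_conv)
  have zero: "unlinked m (U \<alpha>) (space m - A) A" if A: "A \<in> invariant_sets m U" and \<alpha>: "0 < \<alpha>" for A \<alpha>
  proof -
    interpret a: kernel_sub_invariant m "U \<alpha>" \<alpha> by (rule sub_invariant_kernel[OF \<alpha>])
    have Am: "A \<in> sets m" using A by (simp add: invariant_sets_def)
    have "(\<lambda>_. 1) \<in> bounded_pos_measurable m"
      by (auto simp: bounded_pos_measurable_def)
    from invariant_setsD[OF A \<alpha> this] show ?thesis unfolding unlinked_def using AE_space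
    proof eventually_elim
      case (elim x)
      interpret finite_measure "U \<alpha> x" using elim by (intro a.finite_kernel)
      show ?case using elim sets.sets_into_space[OF Am]
        by (auto simp: kernel_op_def a.space_kernel Int_absorb2 emeasure_eq_measure)
    qed
  qed
  show ?thesis
  proof (intro iffI allI impI)
    fix \<alpha> :: real assume "u \<in> borel_measurable (invariant_sigma_algebra m U)" and \<alpha>: "0 < \<alpha>"
    then have A: "{x\<in>space m. u x < q} \<in> invariant_sets m U" for q
      by (simp add: borel_measurable_iff_less sets space)
    have B: "space m - {x\<in>space m. u x < q} \<in> invariant_sets m U" for q
      using sets.compl_sets[of "{x\<in>space m. u x < q}" "invariant_sigma_algebra m U"] A
      by (simp add: sets space)
    have AA: "space m - (space m - {x\<in>space m. u x < q}) = {x\<in>space m. u x < q}" for q by auto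
    show "constant_along m (U \<alpha>) u"
      unfolding kernel_sub_invariant.constant_along_iff_unlinked[OF sub_invariant_kernel[OF \<alpha>] u]
      using zero[OF A \<alpha>] zero[OF B \<alpha>] unfolding AA by blast
  next
    assume const: "\<forall>\<alpha>>0. constant_along m (U \<alpha>) u"
    have "{x\<in>space m. u x < q} \<in> invariant_sets m U" for q
    proof (rule invariant_setsI)
      let ?A = "{x\<in>space m. u x < q}"
      show A[measurable]: "?A \<in> sets m" by measurable
      fix \<alpha> :: real and f assume \<alpha>: "0 < \<alpha>" and f: "f \<in> bounded_pos_measurable m"
      interpret a: kernel_sub_invariant m "U \<alpha>" \<alpha> by (rule sub_invariant_kernel[OF \<alpha>])
      have "constant_along m (U \<alpha>) (indicator ?A)"
        using const[rule_format, OF \<alpha>] AE_space unfolding constant_along_def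
      proof eventually_elim
        case (elim x)
        from elim(1) AE_space[of "U \<alpha> x"] show ?case
          by eventually_elim (simp add: indicator_def a.space_kernel elim)
      qed
      then show "AE x in m. kernel_op (U \<alpha>) (\<lambda>y. indicator ?A y * f y) x
          = indicator ?A x * kernel_op (U \<alpha>) f x"
        using f by (intro a.kernel_op_constant_along) (auto simp: bounded_pos_measurable_def)
    qed
    then show "u \<in> borel_measurable (invariant_sigma_algebra m U)"
      by (simp add: borel_measurable_iff_less sets space)
  qed
qed

end

section \<open>The L^p spaces and the vector lattice\<close>

text \<open>For a finite exponent q, |u| is at most c^(1-q) |u|^q where |u| > c, since 1 - q \<le>
  0. In the remaining case \<open>u\<close> is essentially bounded and \<open>m\<close> is
  finite.\<close>

lemma tails_integrable_L_space:
  assumes p: "1 \<le> p" "p < \<infinity> \<or> p = \<infinity> \<and> emeasure m (space m) < \<infinity>" and u: "u \<in> L_space p m"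
  shows "tails_integrable m u"
  unfolding tails_integrable_def
proof (intro conjI allI impI)
  show [measurable]: "u \<in> borel_measurable m" using u by (simp add: L_space_def)
  fix c :: real assume c: "0 < c"
  show "(\<integral>\<^sup>+x. ennreal (\<bar>u x\<bar> - c) \<partial>m) < \<infinity>"
  proof (cases "p = \<infinity>")
    case True
    then obtain C where C: "AE x in m. \<bar>u x\<bar> \<le> C" using u by (auto simp: L_space_def)
    from C have "AE x in m. ennreal (\<bar>u x\<bar> - c) \<le> ennreal C"
      by eventually_elim (use c in \<open>auto intro!: ennreal_leI\<close>)
    then have "(\<integral>\<^sup>+x. ennreal (\<bar>u x\<bar> - c) \<partial>m) \<le> (\<integral>\<^sup>+x. ennreal C \<partial>m)"
      by (rule nn_integral_mono_AE)
    also have "\<dots> < \<infinity>" using p True by (simp add: ennreal_mult_less_top)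
    finally show ?thesis .
  next
    case False
    define q where "q = enn2real p"
    have q: "1 \<le> q" using enn2real_mono[of 1 p] p False by (simp add: q_def less_top)
    have int: "integrable m (\<lambda>x. \<bar>u x\<bar> powr q)" using u False by (simp add: L_space_def q_def)
    have "(\<integral>\<^sup>+x. ennreal (\<bar>u x\<bar> - c) \<partial>m) \<le> (\<integral>\<^sup>+x. ennreal (\<bar>u x\<bar> powr q * c powr (1 - q)) \<partial>m)"
    proof (intro nn_integral_mono)
      fix x
      show "ennreal (\<bar>u x\<bar> - c) \<le> ennreal (\<bar>u x\<bar> powr q * c powr (1 - q))"
      proof (cases "c < \<bar>u x\<bar>")
        case True
        have "\<bar>u x\<bar> = \<bar>u x\<bar> powr q * \<bar>u x\<bar> powr (1 - q)"
          using True c by (simp flip: powr_add)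
        also have "\<dots> \<le> \<bar>u x\<bar> powr q * c powr (1 - q)"
          using True c q by (intro mult_left_mono powr_mono2') auto
        finally show ?thesis using c by (intro ennreal_leI) linarith
      qed (simp add: ennreal_neg)
    qed
    also have "\<dots> < \<infinity>"
      using integrable_mult_left[OF int, of "c powr (1 - q)"]
      by (subst nn_integral_eq_integral) (auto simp: less_top)
    finally show ?thesis .
  qed
qed

text \<open>One domination criterion serves sums, multiples, maxima and minima: a power of a maximum
  is at most the sum of the powers.\<close>

lemma L_space_dominated:
  assumes p: "1 \<le> p" and v: "v \<in> L_space p m" and w: "w \<in> L_space p m"
    and g[measurable]: "g \<in> borel_measurable m"
    and le: "\<And>x. \<bar>g x\<bar> \<le> C * max \<bar>v x\<bar> \<bar>w x\<bar>" and C: "0 \<le> C"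
  shows "g \<in> L_space p m"
proof (cases "p = \<infinity>")
  case True
  obtain a b where "AE x in m. \<bar>v x\<bar> \<le> a" "AE x in m. \<bar>w x\<bar> \<le> b"
    using v w True by (auto simp: L_space_def)
  then have "AE x in m. \<bar>g x\<bar> \<le> C * max a b"
  proof eventually_elim
    case (elim x)
    have "C * max \<bar>v x\<bar> \<bar>w x\<bar> \<le> C * max a b" using elim C by (intro mult_left_mono) auto
    with le[of x] show ?case by linarith
  qed
  then show ?thesis using True by (auto simp: L_space_def)
next
  case False
  define q where "q = enn2real p"
  have q: "1 \<le> q" using enn2real_mono[of 1 p] p False by (simp add: q_def less_top)
  have int: "integrable m (\<lambda>x. C powr q * (\<bar>v x\<bar> powr q + \<bar>w x\<bar> powr q))"
    using v w False by (auto simp: L_space_def q_def)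
  have "integrable m (\<lambda>x. \<bar>g x\<bar> powr q)"
  proof (rule Bochner_Integration.integrable_bound[OF int])
    show "AE x in m. norm (\<bar>g x\<bar> powr q) \<le> norm (C powr q * (\<bar>v x\<bar> powr q + \<bar>w x\<bar> powr q))"
    proof (rule AE_I2)
      fix x
      have "\<bar>g x\<bar> powr q \<le> (C * max \<bar>v x\<bar> \<bar>w x\<bar>) powr q"
        using le[of x] q by (intro powr_mono2) auto
      also have "\<dots> = C powr q * max \<bar>v x\<bar> \<bar>w x\<bar> powr q" using C by (simp add: powr_mult)
      also have "\<dots> \<le> C powr q * (\<bar>v x\<bar> powr q + \<bar>w x\<bar> powr q)"
        by (intro mult_left_mono) (auto simp: max_def)
      finally show "norm (\<bar>g x\<bar> powr q) \<le> norm (C powr q * (\<bar>v x\<bar> powr q + \<bar>w x\<bar> powr q))" by simp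
    qed
  qed measurable
  then show ?thesis using False by (simp add: L_space_def q_def)
qed

text \<open>The bound on \<open>h\<close> forces \<open>h 0 0 = 0\<close>. Thus where the
  combination is nonzero, \<open>v\<close> or \<open>w\<close> is nonzero and the kernel has full
  mass; the level set property passes to any function of \<open>v\<close> and
  \<open>w\<close>.\<close>

lemma (in sub_invariant_resolvent) invariant_Lp_combine:
  assumes p: "1 \<le> p" "p < \<infinity> \<or> p = \<infinity> \<and> emeasure m (space m) < \<infinity>"
    and v: "v \<in> invariant_Lp p m U" and w: "w \<in> invariant_Lp p m U"
    and h: "(\<lambda>x. h (v x) (w x)) \<in> borel_measurable m" "\<And>a b. \<bar>h a b\<bar> \<le> C * max \<bar>a\<bar> \<bar>b\<bar>"
    and C: "0 \<le> C"
  shows "(\<lambda>x. h (v x) (w x)) \<in> invariant_Lp p m U"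
proof -
  have vL: "v \<in> L_space p m" and wL: "w \<in> L_space p m"
    using v w by (auto simp: invariant_Lp_def)
  have gL: "(\<lambda>x. h (v x) (w x)) \<in> L_space p m"
    by (rule L_space_dominated[OF p(1) vL wL h C])
  have "AE x in m. \<alpha> * kernel_op (U \<alpha>) (\<lambda>x. h (v x) (w x)) x = h (v x) (w x)" if \<alpha>: "0 < \<alpha>" for \<alpha>
  proof -
    interpret a: kernel_sub_invariant m "U \<alpha>" \<alpha> by (rule sub_invariant_kernel[OF \<alpha>])
    note iff = a.harmonic_iff[OF tails_integrable_L_space[OF p]]
    have 1: "constant_along m (U \<alpha>) v" "constant_along m (U \<alpha>) w"
      "AE x in m. v x \<noteq> 0 \<longrightarrow> \<alpha> * measure (U \<alpha> x) (space m) = 1"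
      "AE x in m. w x \<noteq> 0 \<longrightarrow> \<alpha> * measure (U \<alpha> x) (space m) = 1"
      using v w \<alpha> iff[OF vL] iff[OF wL] by (auto simp: invariant_Lp_def)
    have h0: "h 0 0 = 0" using h(2)[of 0 0] by simp
    have "AE x in m. h (v x) (w x) \<noteq> 0 \<longrightarrow> \<alpha> * measure (U \<alpha> x) (space m) = 1"
      using 1(3,4) by eventually_elim (use h0 in auto)
    then show ?thesis
      unfolding iff[OF gL] using constant_along_combine[OF 1(1,2)] by blast
  qed
  then show ?thesis using gL by (simp add: invariant_Lp_def)
qed

lemma (in sub_invariant_resolvent) invariant_Lp_lattice:
  assumes p: "1 \<le> p" "p < \<infinity> \<or> p = \<infinity> \<and> emeasure m (space m) < \<infinity>"
  shows "ae_vector_lattice m (invariant_Lp p m U)"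
    and "\<And>v w. v \<in> invariant_Lp p m U \<Longrightarrow> w \<in> invariant_Lp p m U \<Longrightarrow>
      (\<lambda>x. max (v x) (w x)) \<in> invariant_Lp p m U"
    and "\<And>v w. v \<in> invariant_Lp p m U \<Longrightarrow> w \<in> invariant_Lp p m U \<Longrightarrow>
      (\<lambda>x. min (v x) (w x)) \<in> invariant_Lp p m U"
proof -
  let ?I = "invariant_Lp p m U"
  have meas: "v \<in> borel_measurable m" if "v \<in> ?I" for v
    using that by (simp add: invariant_Lp_def L_space_def)
  have max: "(\<lambda>x. max (v x) (w x)) \<in> ?I" if "v \<in> ?I" "w \<in> ?I" for v w
  proof (rule invariant_Lp_combine[OF p that, where h = max and C = 1])
    show "\<bar>max a b\<bar> \<le> 1 * max \<bar>a\<bar> \<bar>b\<bar>" for a b :: real by linarith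
  qed (use meas that in simp_all)
  have min: "(\<lambda>x. min (v x) (w x)) \<in> ?I" if "v \<in> ?I" "w \<in> ?I" for v w
  proof (rule invariant_Lp_combine[OF p that, where h = min and C = 1])
    show "\<bar>min a b\<bar> \<le> 1 * max \<bar>a\<bar> \<bar>b\<bar>" for a b :: real by linarith
  qed (use meas that in simp_all)
  have zero: "(\<lambda>x. 0) \<in> ?I"
    by (simp add: invariant_Lp_def L_space_def kernel_op_def exI[of _ 0])
  have add: "(\<lambda>x. v x + w x) \<in> ?I" if "v \<in> ?I" "w \<in> ?I" for v w
  proof (rule invariant_Lp_combine[OF p that, where h = "(+)" and C = 2])
    show "\<bar>a + b\<bar> \<le> 2 * max \<bar>a\<bar> \<bar>b\<bar>" for a b :: real by linarith
  qed (use meas that in simp_all)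
  \<comment> \<open>The second argument of \<open>h\<close> is a dummy, filled with \<open>v\<close>
    again.\<close>
  have scale: "(\<lambda>x. c * v x) \<in> ?I" if "v \<in> ?I" for c v
    using meas[OF that]
    by (intro invariant_Lp_combine[OF p that that, where h = "\<lambda>a b. c * a" and C = "\<bar>c\<bar>"])
       (simp_all add: abs_mult mult_left_mono)
  have sup_le: "ae_le m (\<lambda>x. max (v x) (w x)) t" if "ae_le m v t" "ae_le m w t" for v w t
    using that unfolding ae_le_def by eventually_elim simp
  have le_inf: "ae_le m t (\<lambda>x. min (v x) (w x))" if "ae_le m t v" "ae_le m t w" for v w t
    using that unfolding ae_le_def by eventually_elim simp
  have sup: "ae_sup_in m ?I v w (\<lambda>x. max (v x) (w x))" if "v \<in> ?I" "w \<in> ?I" for v w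
    unfolding ae_sup_in_def
    by (intro conjI ballI impI sup_le max[OF that]) (simp_all add: ae_le_def)
  have inf: "ae_inf_in m ?I v w (\<lambda>x. min (v x) (w x))" if "v \<in> ?I" "w \<in> ?I" for v w
    unfolding ae_inf_in_def
    by (intro conjI ballI impI le_inf min[OF that]) (simp_all add: ae_le_def)
  show "ae_vector_lattice m ?I"
    unfolding ae_vector_lattice_def
  proof (intro conjI ballI allI)
    fix v w assume "v \<in> ?I" "w \<in> ?I"
    then show "\<exists>s. ae_sup_in m ?I v w s" "\<exists>s. ae_inf_in m ?I v w s"
      using sup inf by blast+
  qed (use zero add scale in simp_all)
  show "\<And>v w. v \<in> ?I \<Longrightarrow> w \<in> ?I \<Longrightarrow> (\<lambda>x. max (v x) (w x)) \<in> ?I" by (rule max)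
  show "\<And>v w. v \<in> ?I \<Longrightarrow> w \<in> ?I \<Longrightarrow> (\<lambda>x. min (v x) (w x)) \<in> ?I" by (rule min)
qed

section \<open>The equivalences\<close>

theorem theorem2p27:
  fixes m :: "'a measure" and U U' :: "real \<Rightarrow> 'a \<Rightarrow> 'a measure"
    and p :: ennreal and u :: "'a \<Rightarrow> real"
  assumes "lusin_measurable_space m"
    and "sub_markovian_resolvent m U"
    and "sigma_finite_measure m"
    and "sub_invariant_measure m U"
    and "adjoint_resolvent m U U'"
    and "1 \<le> p" and "p < \<infinity> \<or> p = \<infinity> \<and> emeasure m (space m) < \<infinity>"
    and "u \<in> L_space p m"
  shows
    "let I_at = (\<lambda>\<alpha>. AE x in m. \<alpha> * kernel_op (U \<alpha>) u x = u x);
         I = (\<forall>\<alpha>>0. I_at \<alpha>);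
         II = (\<forall>\<alpha>>0. AE x in m. \<alpha> * kernel_op (U' \<alpha>) u x = u x);
         III = invariant_fun m U u;
         IV_at = (\<lambda>\<alpha>. (AE x in m. kernel_op (U \<alpha>) u x = u x * kernel_op (U \<alpha>) (\<lambda>_. 1) x) \<and>
                      (AE x in m. kernel_op (U' \<alpha>) u x = u x * kernel_op (U' \<alpha>) (\<lambda>_. 1) x));
         IV = (\<forall>\<alpha>>0. IV_at \<alpha>);
         V = (u \<in> borel_measurable (invariant_sigma_algebra m U))
     in ae_vector_lattice m (invariant_Lp p m U) \<and>
        (\<forall>v\<in>invariant_Lp p m U. \<forall>w\<in>invariant_Lp p m U.
           (\<lambda>x. max (v x) (w x)) \<in> invariant_Lp p m U \<and>
           (\<lambda>x. min (v x) (w x)) \<in> invariant_Lp p m U) \<and>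
        ((\<exists>\<alpha>>0. I_at \<alpha>) \<longleftrightarrow> I) \<and>
        ((\<exists>\<alpha>>0. IV_at \<alpha>) \<longleftrightarrow> IV) \<and>
        (I \<longleftrightarrow> II) \<and> (II \<longrightarrow> III) \<and> (III \<longleftrightarrow> IV) \<and> (IV \<longleftrightarrow> V) \<and>
        ((\<forall>\<alpha>>0. AE x in m. \<alpha> * kernel_op (U \<alpha>) (\<lambda>_. 1) x = 1) \<or>
         (\<forall>\<alpha>>0. AE x in m. \<alpha> * kernel_op (U' \<alpha>) (\<lambda>_. 1) x = 1) \<longrightarrow>
           (I \<longleftrightarrow> II) \<and> (II \<longleftrightarrow> III) \<and> (III \<longleftrightarrow> IV) \<and> (IV \<longleftrightarrow> V))"
proof -
  note U = assms(2) and adj = assms(5) and p = assms(6,7) and uL = assms(8)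
  have V: "sub_markovian_resolvent m U'" using adj by (simp add: adjoint_resolvent_def)
  have dual: "dual_kernels m (U \<alpha>) (U' \<alpha>) \<alpha>" if "0 < \<alpha>" for \<alpha>
    using U V adj that
    unfolding dual_kernels_def sub_markovian_resolvent_def adjoint_resolvent_def
    by (intro conjI allI impI) (simp_all only:)
  note dual' = dual_kernels_swap[OF dual]
  interpret U: sub_invariant_resolvent m U
    by (rule sub_invariant_resolvent.intro[OF U dual_kernels.kernel_sub_invariant[OF dual]])
  interpret V: sub_invariant_resolvent m U'
    by (rule sub_invariant_resolvent.intro[OF V dual_kernels.kernel_sub_invariant[OF dual']])
  have tails: "tails_integrable m u" by (rule tails_integrable_L_space[OF p uL])
  have um: "u \<in> borel_measurable m" using uL by (simp add: L_space_def)
  have uLq: "u \<in> (\<Union>q\<in>{1..\<infinity>}. L_space q m)" using uL p by (auto intro!: bexI[of _ p])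
  \<comment> \<open>\<open>?H\<close> stands for (I) or (II), \<open>?E\<close> for one equation of
    (IV), and \<open>?D\<close> for the level set property, to which (III), (IV) and (V) are all
    reduced.\<close>
  let ?H = "\<lambda>U \<alpha>. AE x in m. \<alpha> * kernel_op (U \<alpha>) u x = u x"
  let ?D = "\<lambda>U \<alpha>. constant_along m (U \<alpha>) u"
  let ?E = "\<lambda>U \<alpha>. AE x in m. kernel_op (U \<alpha>) u x = u x * kernel_op (U \<alpha>) (\<lambda>_. 1) x"
  have D_dual: "?D U \<alpha> \<longleftrightarrow> ?D U' \<alpha>" if "0 < \<alpha>" for \<alpha>
    by (rule dual_kernels.constant_along_dual[OF dual[OF that] um])
  have D_all: "?D U \<beta>" if "0 < \<alpha>" "0 < \<beta>" "?D U \<alpha>" for \<alpha> \<beta>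
    by (rule U.constant_along_resolvent[OF um that])
  have H: "?H U \<alpha> \<longleftrightarrow> ?D U \<alpha> \<and> (AE x in m. u x \<noteq> 0 \<longrightarrow> \<alpha> * measure (U \<alpha> x) (space m) = 1)"
    if "0 < \<alpha>" for \<alpha>
    by (rule kernel_sub_invariant.harmonic_iff[OF U.sub_invariant_kernel[OF that] tails])
  have H': "?H U' \<alpha> \<longleftrightarrow> ?D U' \<alpha> \<and> (AE x in m. u x \<noteq> 0 \<longrightarrow> \<alpha> * measure (U' \<alpha> x) (space m) = 1)"
    if "0 < \<alpha>" for \<alpha>
    by (rule kernel_sub_invariant.harmonic_iff[OF V.sub_invariant_kernel[OF that] tails])
  have H_dual: "?H U \<alpha> \<longleftrightarrow> ?H U' \<alpha>" if "0 < \<alpha>" for \<alpha>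
    using dual_kernels.mass_one_dual[OF dual[OF that] tails]
      dual_kernels.mass_one_dual[OF dual'[OF that] tails] D_dual[OF that]
    unfolding H[OF that] H'[OF that] by blast
  have H_all: "?H U \<beta>" if "0 < \<alpha>" "0 < \<beta>" "?H U \<alpha>" for \<alpha> \<beta>
    by (rule U.harmonic_resolvent[OF tails that])
  have D_E: "?E U \<alpha>" if "0 < \<alpha>" "?D U \<alpha>" for \<alpha>
    using kernel_sub_invariant.kernel_op_constant_along[OF U.sub_invariant_kernel[OF that(1)] um _ that(2),
        of "\<lambda>_. 1"] by simp
  have D_E': "?E U' \<alpha>" if "0 < \<alpha>" "?D U \<alpha>" for \<alpha>
    using kernel_sub_invariant.kernel_op_constant_along[OF V.sub_invariant_kernel[OF that(1)] um _,
        of "\<lambda>_. 1"] that D_dual by simp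
  have E: "?E U \<alpha> \<and> ?E U' \<alpha> \<longleftrightarrow> ?D U \<alpha>" if "0 < \<alpha>" for \<alpha>
    using dual_kernels.constant_along_if_kernel_op_eq[OF dual[OF that] tails] D_E[OF that] D_E'[OF that]
    by blast
  have III: "invariant_fun m U u \<longleftrightarrow> (\<forall>\<alpha>>0. ?D U \<alpha>)"
    by (rule U.invariant_fun_iff_constant_along[OF uLq])
  have V: "u \<in> borel_measurable (invariant_sigma_algebra m U) \<longleftrightarrow> (\<forall>\<alpha>>0. ?D U \<alpha>)"
    by (rule U.measurable_invariant_iff_constant_along[OF um])
  have markov: "?H U \<alpha>" if "0 < \<alpha>" "?D U \<alpha>" and one: "AE x in m. \<alpha> * kernel_op (U \<alpha>) (\<lambda>_. 1) x = 1" for \<alpha>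
    using D_E[OF that(1,2)] one
    by eventually_elim (simp add: mult.left_commute)
  \<comment> \<open>Full mass of the adjoint yields (II) at this parameter, and
    \<open>H_dual\<close> carries it back to (I).\<close>
  have markov': "?H U \<alpha>" if "0 < \<alpha>" "?D U \<alpha>" and one: "AE x in m. \<alpha> * kernel_op (U' \<alpha>) (\<lambda>_. 1) x = 1" for \<alpha>
    unfolding H_dual[OF that(1)] using D_E'[OF that(1,2)] one
    by eventually_elim (simp add: mult.left_commute)
  \<comment> \<open>The parameter 1 is the witness in passing from all parameters to some
    parameter.\<close>
  have one_pos: "(0::real) < 1" by simp
  have I_ex: "(\<exists>\<alpha>>0. ?H U \<alpha>) \<longleftrightarrow> (\<forall>\<alpha>>0. ?H U \<alpha>)"
    using H_all one_pos by blast
  have D_ex: "(\<exists>\<alpha>>0. ?D U \<alpha>) \<longleftrightarrow> (\<forall>\<alpha>>0. ?D U \<alpha>)"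
    using D_all one_pos by blast
  have IV: "(\<forall>\<alpha>>0. ?E U \<alpha> \<and> ?E U' \<alpha>) \<longleftrightarrow> (\<forall>\<alpha>>0. ?D U \<alpha>)"
    using E by blast
  have IV_ex: "(\<exists>\<alpha>>0. ?E U \<alpha> \<and> ?E U' \<alpha>) \<longleftrightarrow> (\<forall>\<alpha>>0. ?D U \<alpha>)"
    using E D_ex by blast
  have II: "(\<forall>\<alpha>>0. ?H U' \<alpha>) \<longleftrightarrow> (\<forall>\<alpha>>0. ?H U \<alpha>)" using H_dual by blast
  have HD: "(\<forall>\<alpha>>0. ?H U \<alpha>) \<longrightarrow> (\<forall>\<alpha>>0. ?D U \<alpha>)" using H by blast
  have DH: "(\<forall>\<alpha>>0. AE x in m. \<alpha> * kernel_op (U \<alpha>) (\<lambda>_. 1) x = 1) \<or>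
      (\<forall>\<alpha>>0. AE x in m. \<alpha> * kernel_op (U' \<alpha>) (\<lambda>_. 1) x = 1) \<longrightarrow>
      (\<forall>\<alpha>>0. ?D U \<alpha>) \<longrightarrow> (\<forall>\<alpha>>0. ?H U \<alpha>)"
    using markov markov' by blast
  show ?thesis
    unfolding Let_def I_ex IV_ex II III IV V
  proof (intro conjI ballI)
    show "ae_vector_lattice m (invariant_Lp p m U)" by (rule U.invariant_Lp_lattice(1)[OF p])
  qed (use HD DH in \<open>auto simp only: intro: U.invariant_Lp_lattice(2,3)[OF p]\<close>)
qed

end
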